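(* Let $\omega$ be a function of modulus of continuity type on $[0,2\pi]$ and let $H:(0,\pi]\to[0,\infty)$ be a function such that $$\int_{u}^{\pi}t^{-2}\omega(t)\,dt=O(H(u))\quad\text{and}\quad\int_{0}^{u}H(t)\,dt=O(uH(u))\qquad\text{for }u\in(0,\pi].$$ Let $f\in X_{\omega}$ and let $r$ be a positive integer. Then, for $n=0,1,2,\dots$, $$\left\|\widetilde{T}_{n,A}f(\cdot)-\widetilde{f}(\cdot)\right\|_{X}=O\left(H\left(\frac{\pi}{n+1}\right)\left(\frac{\pi}{n+1}+A_{n,r}\right)\right)$$ and $$\left\|\widetilde{T}_{n,A}f(\cdot)-\widetilde{f}\left(\cdot,\frac{\pi}{r(n+1)}\right)\right\|_{X}=O\left(H\left(\frac{\pi}{n+1}\right)\left(\frac{\pi}{n+1}+A_{n,r}\right)\right).$$ Additionally, if the matrix $A$ is such that $$\left[\sum_{l=0}^{n}\sum_{k=l}^{r+l-1}a_{n,k}\right]^{-1}=O(1),$$ then $$\left\|\widetilde{T}_{n,A}f(\cdot)-\widetilde{f}(\cdot)\right\|_{X}=O\left(H\left(\frac{\pi}{n+1}\right)A_{n,r}\right)$$ and $$\left\|\widetilde{T}_{n,A}f(\cdot)-\widetilde{f}\left(\cdot,\frac{\pi}{r(n+1)}\right)\right\|_{X}=O\left(H\left(\frac{\pi}{n+1}\right)A_{n,r}\right).$$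
   Context: $X$ denotes either $L^{p}$ ($1\le p\le\infty$), the space of $2\pi$-periodic real-valued functions that are Lebesgue integrable with $p$-th power over $Q=[-\pi,\pi]$ (essentially bounded if $p=\infty$), with norm $\|f\|_{L^p}=(\int_Q|f(t)|^p\,dt)^{1/p}$ for $p<\infty$ and $\|f\|_{L^\infty}=\operatorname{ess\,sup}_{t\in Q}|f(t)|$; or $C$, the space of continuous $2\pi$-periodic real-valued functions with the sup norm. For $f\in X$ with real Fourier coefficients $a_\nu(f)=\frac1\pi\int_{-\pi}^{\pi}f(t)\cos\nu t\,dt$, $b_\nu(f)=\frac1\pi\int_{-\pi}^{\pi}f(t)\sin\nu t\,dt$, the partial sums of the conjugate Fourier series are $\widetilde S_kf(x)=\sum_{\nu=1}^{k}(a_\nu(f)\sin\nu x-b_\nu(f)\cos\nu x)$ (so $\widetilde S_0f=0$). Put $\psi_x(t)=f(x+t)-f(x-t)$, and for $\epsilon>0$ $$\widetilde f(x,\epsilon)=-\frac1\pi\int_\epsilon^\pi\psi_x(t)\,\frac12\cot\frac t2\,dt,\qquad \widetilde f(x)=\lim_{\epsilon\to0^+}\widetilde f(x,\epsilon),$$ the latter existing for almost all $x$. $A=(a_{n,k})_{n,k\ge0}$ is an infinite matrix of real numbers with $a_{n,k}\ge0$ for all $n,k$, $\lim_{n\to\infty}a_{n,k}=0$ for each $k$, and $\sum_{k=0}^\infty a_{n,k}=1$ for each $n$. For a positive integer $r$, $A_{n,r}=\sum_{k=0}^\infty|a_{n,k}-a_{n,k+r}|$. Further $\widetilde T_{n,A}f(x)=\sum_{k=0}^\infty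 a_{n,k}\widetilde S_kf(x)$, $n=0,1,2,\dots$. The second conjugate modulus of continuity is $\widetilde\omega_2(f,\delta)_X=\sup_{0<t\le\delta}\|\psi_\cdot(t)\|_X$ (equal to $0$ for $\delta=0$). A function of modulus of continuity type on $[0,2\pi]$ is a nondecreasing continuous function $\omega$ with $\omega(0)=0$ and $\omega(\delta_1+\delta_2)\le\omega(\delta_1)+\omega(\delta_2)$ for all $0\le\delta_1\le\delta_2\le\delta_1+\delta_2\le2\pi$. For such $\omega$, $X_\omega=\{f\in X:\widetilde\omega_2(f,\delta)_X=O(\omega(\delta))\text{ for }\delta\in[0,2\pi]\}$. All $O$-relations are uniform over the indicated range of the variable ($u$, $\delta$, or $n=0,1,2,\dots$): the implied constants do not depend on $u$, $\delta$, $n$ (they may depend on $f,\omega,H,r,A$). *)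

theory Defs
  imports "HOL-Probability.Probability" "HOL-Library.Landau_Symbols"
begin

datatype per_space = Lp real | Linf | Cont

primrec admissible :: "per_space \<Rightarrow> bool" where
  "admissible (Lp p) \<longleftrightarrow> 1 \<le> p"
| "admissible Linf \<longleftrightarrow> True"
| "admissible Cont \<longleftrightarrow> True"

abbreviation Q :: "real set" where
  "Q \<equiv> {-pi..pi}"

definition periodic_2pi :: "(real \<Rightarrow> real) \<Rightarrow> bool" where
  "periodic_2pi f \<longleftrightarrow> (\<forall>x. f (x + 2 * pi) = f x)"

primrec X_carrier :: "per_space \<Rightarrow> (real \<Rightarrow> real) set" where
  "X_carrier (Lp p) = {f. periodic_2pi f \<and> f \<in> borel_measurable lebesgue \<and>
      set_integrable lebesgue Q (\<lambda>t. \<bar>f t\<bar> powr p)}"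
| "X_carrier Linf = {f. periodic_2pi f \<and> f \<in> borel_measurable lebesgue \<and>
      esssup (restrict_space lebesgue Q) (\<lambda>t. ereal \<bar>f t\<bar>) < \<infinity>}"
| "X_carrier Cont = {f. periodic_2pi f \<and> continuous_on UNIV f}"

text \<open>The value of \<open>X_norm X f\<close> is meaningful only for \<open>f \<in> X_carrier X\<close>: outside it, the
  integral or supremum takes a default value.\<close>

primrec X_norm :: "per_space \<Rightarrow> (real \<Rightarrow> real) \<Rightarrow> real" where
  "X_norm (Lp p) f = (LINT t:Q|lebesgue. \<bar>f t\<bar> powr p) powr (1 / p)"
| "X_norm Linf f = real_of_ereal (esssup (restrict_space lebesgue Q) (\<lambda>t. ereal \<bar>f t\<bar>))"
| "X_norm Cont f = (SUP t\<in>Q. \<bar>f t\<bar>)"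

definition fourier_a :: "(real \<Rightarrow> real) \<Rightarrow> nat \<Rightarrow> real" where
  "fourier_a f \<nu> = 1 / pi * (LINT t:Q|lebesgue. f t * cos (real \<nu> * t))"

definition fourier_b :: "(real \<Rightarrow> real) \<Rightarrow> nat \<Rightarrow> real" where
  "fourier_b f \<nu> = 1 / pi * (LINT t:Q|lebesgue. f t * sin (real \<nu> * t))"

definition conj_partial_sum :: "(real \<Rightarrow> real) \<Rightarrow> nat \<Rightarrow> real \<Rightarrow> real" where
  "conj_partial_sum f k x =
     (\<Sum>\<nu>=1..k. fourier_a f \<nu> * sin (real \<nu> * x) - fourier_b f \<nu> * cos (real \<nu> * x))"

definition psi :: "(real \<Rightarrow> real) \<Rightarrow> real \<Rightarrow> real \<Rightarrow> real" where
  "psi f x t = f (x + t) - f (x - t)"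

definition conj_trunc :: "(real \<Rightarrow> real) \<Rightarrow> real \<Rightarrow> real \<Rightarrow> real" where
  "conj_trunc f x \<epsilon> = - (1 / pi) * (LINT t:{\<epsilon>..pi}|lebesgue. psi f x t * (1 / 2 * cot (t / 2)))"

text \<open>\<open>Lim\<close> takes an unspecified value at the points where the limit does not exist; for
  \<open>2\<pi>\<close>-periodic \<open>f\<close> integrable over \<open>Q\<close> these form a null set.\<close>

definition conj_fun :: "(real \<Rightarrow> real) \<Rightarrow> real \<Rightarrow> real" where
  "conj_fun f x = Lim (at_right 0) (\<lambda>\<epsilon>. conj_trunc f x \<epsilon>)"

definition summation_matrix :: "(nat \<Rightarrow> nat \<Rightarrow> real) \<Rightarrow> bool" where
  "summation_matrix a \<longleftrightarrow> (\<forall>n k. 0 \<le> a n k) \<and> (\<forall>k. (\<lambda>n. a n k) \<longlonglongrightarrow> 0) \<and> (\<forall>n. a n sums 1)"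

definition mat_var :: "(nat \<Rightarrow> nat \<Rightarrow> real) \<Rightarrow> nat \<Rightarrow> nat \<Rightarrow> real" where
  "mat_var a n r = (\<Sum>k. \<bar>a n k - a n (k + r)\<bar>)"

definition conj_mean :: "(nat \<Rightarrow> nat \<Rightarrow> real) \<Rightarrow> (real \<Rightarrow> real) \<Rightarrow> nat \<Rightarrow> real \<Rightarrow> real" where
  "conj_mean a f n x = (\<Sum>k. a n k * conj_partial_sum f k x)"

definition conj_modulus2 :: "per_space \<Rightarrow> (real \<Rightarrow> real) \<Rightarrow> real \<Rightarrow> real" where
  "conj_modulus2 X f \<delta> = (if \<delta> = 0 then 0 else (SUP t\<in>{0<..\<delta>}. X_norm X (\<lambda>x. psi f x t)))"

definition modulus_type :: "(real \<Rightarrow> real) \<Rightarrow> bool" where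
  "modulus_type \<omega> \<longleftrightarrow>
     mono_on {0..2 * pi} \<omega> \<and> continuous_on {0..2 * pi} \<omega> \<and> \<omega> 0 = 0 \<and>
     (\<forall>\<delta>1 \<delta>2. 0 \<le> \<delta>1 \<and> \<delta>1 \<le> \<delta>2 \<and> \<delta>2 \<le> \<delta>1 + \<delta>2 \<and> \<delta>1 + \<delta>2 \<le> 2 * pi \<longrightarrow>
        \<omega> (\<delta>1 + \<delta>2) \<le> \<omega> \<delta>1 + \<omega> \<delta>2)"

text \<open>\<open>f \<in> O[principal S](g)\<close> unfolds to \<open>\<exists>c>0. \<forall>x\<in>S. \<bar>f x\<bar> \<le> c * \<bar>g x\<bar>\<close>, that is, an O-relation
  that is uniform over all of \<open>S\<close> and not merely asymptotic.\<close>

definition X_class :: "per_space \<Rightarrow> (real \<Rightarrow> real) \<Rightarrow> (real \<Rightarrow> real) set" where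
  "X_class X \<omega> = {f \<in> X_carrier X. conj_modulus2 X f \<in> O[principal {0..2 * pi}](\<omega>)}"

end

theory Submission
  imports Defs
begin

text \<open>
  Let \<open>K t\<close> be the average of \<open>cos ((k + 1/2) t)\<close> with weights \<open>a n k\<close>. At every point \<open>x\<close> where
  \<open>psi f x t / t\<close> is integrable on \<open>(0, \<pi>]\<close>, the deviation of the matrix mean from the conjugate function
  is the integral of \<open>psi f x t\<close> against \<open>K t / (2 \<pi> sin (t/2))\<close>, and truncating the conjugate function at
  \<open>\<epsilon>\<close> changes this kernel by \<open>1/2 cot (t/2) / \<pi>\<close> on \<open>(0, \<epsilon>)\<close> (\<open>conj_mean_minus_conj_fun\<close>,
  \<open>conj_mean_minus_conj_trunc\<close>). The norm of \<open>psi f \<cdot> t\<close> is \<open>O(\<omega> t)\<close>, so by Minkowski's integral inequality,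
  or pointwise domination for the supremum norms, the norm of the deviation is at most a constant
  times the integral of \<open>\<omega> t\<close> times the modulus of the kernel (\<open>kernel_transform_norm_le\<close>). What remains is
  one real integral.

  Two bounds for \<open>K\<close> are available: \<open>\<bar>K t\<bar> \<le> 1\<close>, and \<open>\<bar>sin (r t / 2) K t\<bar> \<le> V\<close> with \<open>V\<close> the variation of the row at
  lag \<open>r\<close>, by summation by parts (\<open>sin_mult_mean_kernel_le\<close>). Near \<open>0\<close> the first is used up to
  \<open>h = \<pi> / (n + 1)\<close> and the second from there on; this needs that the integral of \<open>\<omega> t / t\<close> over \<open>(0, h]\<close> is
  \<open>O(h H(h))\<close> and that of \<open>\<omega> t / t\<^sup>2\<close> over \<open>[h, \<pi>]\<close> is \<open>O(H(h))\<close>. The latter is assumed, and the former follows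
  by integrating the latter over \<open>(0, h]\<close> and using the condition on the mean of \<open>H\<close> (\<open>dini_bounds\<close>).
  For \<open>r \<ge> 2\<close> the sine has further zeros \<open>2 \<pi> m / r\<close>. There the
  monotonicity of \<open>\<omega> t / t\<close> up to a factor \<open>2\<close> replaces \<open>\<omega> t / t\<close> by \<open>\<omega> s / s\<close>, with \<open>s\<close> the distance to the zero,
  and the same two integrals appear again (\<open>modulus_times_mean_kernel_le\<close>). The total is
  \<open>O(H(h) (h + V))\<close>.

  The sum of \<open>r\<close> consecutive entries of a row is at most \<open>V\<close>. Hence the additional condition on the matrix
  bounds \<open>(n + 1) V\<close> from below, and \<open>h = O(V)\<close> (\<open>mesh_le_mat_var\<close>).
\<close>

section \<open>Moduli of continuity\<close>

lemma modulus_nonneg: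
  assumes "modulus_type \<omega>" "0 \<le> t" "t \<le> 2 * pi"
  shows "0 \<le> \<omega> t"
proof -
  have "\<omega> 0 \<le> \<omega> t"
    using assms unfolding modulus_type_def by (intro mono_onD[of "{0..2 * pi}" \<omega>]) auto
  then show ?thesis using assms(1) by (simp add: modulus_type_def)
qed

lemma modulus_multiple:
  assumes "modulus_type \<omega>" "0 < s" "real (Suc k) * s \<le> 2 * pi"
  shows "\<omega> (real (Suc k) * s) \<le> real (Suc k) * \<omega> s"
  using assms(3)
proof (induction k)
  case 0
  then show ?case by simp
next
  case (Suc k)
  have le: "real (Suc k) * s \<le> 2 * pi"
    using Suc.prems \<open>0 < s\<close> by (smt (verit) mult_right_mono of_nat_Suc)
  have "\<omega> (s + real (Suc k) * s) \<le> \<omega> s + \<omega> (real (Suc k) * s)"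
  proof -
    have "s \<le> real (Suc k) * s" "s + real (Suc k) * s \<le> 2 * pi"
      using Suc.prems \<open>0 < s\<close> by (simp_all add: algebra_simps)
    then show ?thesis
      using assms(1) \<open>0 < s\<close> unfolding modulus_type_def by simp
  qed
  also have "\<dots> \<le> \<omega> s + real (Suc k) * \<omega> s"
    using Suc.IH[OF le] by simp
  finally show ?case by (simp add: algebra_simps)
qed

text \<open>Subadditivity makes \<open>\<omega> t / t\<close> decreasing up to the factor \<open>2\<close>: \<open>t\<close> is at most
  \<open>\<lceil>t / s\<rceil> s\<close>, and \<open>\<lceil>t / s\<rceil> \<le> 2 t / s\<close>. The multiple of \<open>s\<close> used here may exceed \<open>\<pi>\<close>, but not
  \<open>2\<pi>\<close>, which is where the range \<open>[0, 2\<pi>]\<close> of the modulus enters.\<close>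

lemma modulus_quotient:
  assumes "modulus_type \<omega>" "0 < s" "s \<le> t" "t \<le> pi"
  shows "\<omega> t / t \<le> 2 * (\<omega> s / s)"
proof -
  define k where "k = nat \<lceil>t / s\<rceil> - 1"
  have ts: "1 \<le> t / s" using assms by simp
  then have k: "real (Suc k) = of_int \<lceil>t / s\<rceil>"
    unfolding k_def by linarith
  have lo: "t / s \<le> real (Suc k)" and hi: "real (Suc k) \<le> t / s + 1"
    unfolding k by linarith+
  have t_le: "t \<le> real (Suc k) * s" using lo \<open>0 < s\<close> by (simp add: field_simps)
  have le_ts: "real (Suc k) * s \<le> t + s" using hi \<open>0 < s\<close> by (simp add: field_simps)
  then have le: "real (Suc k) * s \<le> 2 * pi" using assms by linarith
  have "\<omega> t \<le> \<omega> (real (Suc k) * s)"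
    using assms t_le le unfolding modulus_type_def
    by (intro mono_onD[of "{0..2 * pi}" \<omega>]) auto
  also have "\<dots> \<le> real (Suc k) * \<omega> s"
    by (rule modulus_multiple[OF assms(1,2) le])
  also have "\<dots> \<le> (2 * (t / s)) * \<omega> s"
    using hi ts modulus_nonneg[OF assms(1), of s] assms(2-4)
    by (intro mult_right_mono) linarith+
  finally show ?thesis using assms by (simp add: field_simps)
qed

section \<open>The averaged cosine kernel\<close>

lemma sin_ge_linear:
  fixes x :: real
  assumes "0 \<le> x" "x \<le> pi / 2"
  shows "2 * x / pi \<le> sin x"
proof -
  have conc: "concave_on {0..pi} sin"
    by (rule f''_le0_imp_concave[where f' = cos and f'' = "\<lambda>x. - sin x"])
       (auto intro!: derivative_eq_intros sin_ge_zero)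
  have "sin ((1 - 2 * x / pi) *\<^sub>R 0 + (2 * x / pi) *\<^sub>R (pi / 2))
      \<ge> (1 - 2 * x / pi) * sin 0 + (2 * x / pi) * sin (pi / 2)"
    by (rule concave_onD[OF conc]) (use assms in \<open>auto simp: field_simps\<close>)
  then show ?thesis by simp
qed

lemma abs_sin_ge_linear:
  fixes x :: real
  assumes "\<bar>x\<bar> \<le> pi / 2"
  shows "2 * \<bar>x\<bar> / pi \<le> \<bar>sin x\<bar>"
proof -
  have "2 * \<bar>x\<bar> / pi \<le> sin \<bar>x\<bar>" by (rule sin_ge_linear) (use assms in auto)
  also have "\<dots> \<le> \<bar>sin x\<bar>" by (cases "0 \<le> x") (simp_all only: abs_of_nonneg abs_of_neg not_le sin_minus abs_ge_self abs_ge_minus_self)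
  finally show ?thesis .
qed

text \<open>The conjugate Dirichlet kernel is \<open>1/2 cot (t/2) - cos ((k + 1/2) t) / (2 sin (t/2))\<close>, and only its
  second part distinguishes \<open>k\<close>-th partial sums from the conjugate function. Averaging the cosines
  with a row of the matrix gives this function.\<close>

definition mean_kernel :: "(nat \<Rightarrow> real) \<Rightarrow> real \<Rightarrow> real" where
  "mean_kernel c t = (\<Sum>k. c k * cos ((real k + 1 / 2) * t))"

text \<open>The quantity \<open>mat_var\<close> of a single row.\<close>

definition step_variation :: "(nat \<Rightarrow> real) \<Rightarrow> nat \<Rightarrow> real" where
  "step_variation c r = (\<Sum>k. \<bar>c k - c (k + r)\<bar>)"

context
  fixes c :: "nat \<Rightarrow> real"
  assumes nn: "\<And>k. 0 \<le> c k" and c1: "c sums 1"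
begin

lemma summable_mult_bounded:
  assumes "\<And>k. \<bar>b k\<bar> \<le> 1"
  shows "summable (\<lambda>k. c k * b k)"
proof (rule summable_comparison_test'[of c 0])
  show "norm (c k * b k) \<le> c k" for k
    using mult_left_mono[OF assms, of "c k" k] nn by (simp add: abs_mult)
qed (use c1 in \<open>auto simp: sums_iff\<close>)

lemma summable_mult_bounded_shift:
  assumes "\<And>k. \<bar>b k\<bar> \<le> 1"
  shows "summable (\<lambda>k. c (k + r) * b k)"
proof (rule summable_comparison_test'[of "\<lambda>k. c (k + r)" 0])
  show "norm (c (k + r) * b k) \<le> c (k + r)" for k
    using mult_left_mono[OF assms, of "c (k + r)" k] nn by (simp add: abs_mult)
qed (use c1 in \<open>auto simp: sums_iff summable_iff_shift\<close>)

lemma summable_step_variation: "summable (\<lambda>k. \<bar>c k - c (k + r)\<bar>)"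
proof (rule summable_comparison_test'[of "\<lambda>k. c k + c (k + r)" 0])
  show "norm \<bar>c k - c (k + r)\<bar> \<le> c k + c (k + r)" for k
    using nn[of k] nn[of "k + r"] by simp
qed (use c1 in \<open>auto simp: sums_iff summable_iff_shift intro!: summable_add\<close>)

lemma step_variation_nonneg: "0 \<le> step_variation c r"
  unfolding step_variation_def by (intro suminf_nonneg summable_step_variation) auto

text \<open>The sum over \<open>r\<close> consecutive entries telescopes along the lag \<open>r\<close>: it is the sum of
  \<open>c k - c (k + r)\<close> over all \<open>k \<ge> l\<close>.\<close>

lemma block_sum_le_step_variation: "(\<Sum>k=l..<l + r. c k) \<le> step_variation c r"
proof -
  have s: "summable c" using c1 by (simp add: sums_iff)
  have sl: "summable (\<lambda>k. c (k + l))" for l using s by (simp add: summable_iff_shift)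
  have "(\<Sum>k=l..<l + r. c k) = (\<Sum>k<l + r. c k) - (\<Sum>k<l. c k)"
    using sum.atLeastLessThan_concat[of 0 l "l + r" c] by (simp add: atLeast0LessThan)
  also have "\<dots> = (\<Sum>k. c (k + l)) - (\<Sum>k. c (k + (l + r)))"
    using suminf_split_initial_segment[OF s, of l] suminf_split_initial_segment[OF s, of "l + r"]
    by simp
  also have "\<dots> = (\<Sum>k. c (k + l) - c (k + l + r))"
    using suminf_diff[OF sl[of l] sl[of "l + r"]] by (simp add: add.assoc)
  also have "\<dots> \<le> (\<Sum>k. \<bar>c (k + l) - c (k + l + r)\<bar>)"
    using summable_step_variation[of r] sl[of l] sl[of "l + r"]
    by (intro suminf_le summable_diff)
       (auto simp: add.assoc summable_iff_shift[of "\<lambda>k. \<bar>c k - c (k + r)\<bar>" l, simplified add.assoc])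
  also have "\<dots> \<le> step_variation c r"
    unfolding step_variation_def
    using suminf_split_initial_segment[OF summable_step_variation[of r], of l]
      sum_nonneg[of "{..<l}" "\<lambda>k. \<bar>c k - c (k + r)\<bar>"] by simp
  finally show ?thesis .
qed

lemma abs_mean_kernel_le_1: "\<bar>mean_kernel c t\<bar> \<le> 1"
proof -
  have le: "norm (c k * cos ((real k + 1 / 2) * t)) \<le> c k" for k
    using mult_left_mono[OF abs_cos_le_one nn[of k]] nn[of k] by (simp add: abs_mult)
  have sc: "summable c" using c1 by (simp add: sums_iff)
  have sn: "summable (\<lambda>k. norm (c k * cos ((real k + 1 / 2) * t)))"
    by (rule summable_comparison_test'[OF sc, of 0]) (use le in simp)
  have "norm (mean_kernel c t) \<le> suminf c"
    unfolding mean_kernel_def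
    by (rule order_trans[OF summable_norm[OF sn] suminf_le[OF le sn sc]])
  then show ?thesis using c1 by (simp add: sums_iff)
qed

text \<open>Multiplication by \<open>2 sin (r t / 2)\<close> turns \<open>cos ((k + 1/2) t)\<close> into a difference of sines whose
  frequencies are \<open>r\<close> apart. Summation by parts moves that difference to the coefficients,
  except for the first \<open>r\<close> terms, which form a block controlled by the previous estimate.\<close>

lemma sin_mult_mean_kernel_le:
  "\<bar>sin (real r * t / 2) * mean_kernel c t\<bar> \<le> step_variation c r"
proof -
  define b where "b k = sin ((real k + 1 / 2 - real r / 2) * t)" for k
  have b1: "\<bar>b k\<bar> \<le> 1" for k by (simp add: b_def)
  have prod: "2 * sin (real r * t / 2) * cos ((real k + 1 / 2) * t) = b (k + r) - b k" for k
  proof -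
    have "b (k + r) = sin ((real k + 1 / 2) * t + real r * t / 2)"
      "b k = sin ((real k + 1 / 2) * t - real r * t / 2)"
      by (simp_all add: b_def algebra_simps)
    then show ?thesis by (simp add: sin_add sin_diff)
  qed
  have s1: "summable (\<lambda>k. c k * b (k + r))" and s2: "summable (\<lambda>k. c k * b k)"
    and s3: "summable (\<lambda>k. c (k + r) * b (k + r))"
    by (intro summable_mult_bounded summable_mult_bounded_shift b1)+
  have "2 * sin (real r * t / 2) * mean_kernel c t
      = (\<Sum>k. 2 * sin (real r * t / 2) * (c k * cos ((real k + 1 / 2) * t)))"
    unfolding mean_kernel_def
    by (intro suminf_mult[symmetric] summable_mult_bounded) simp
  also have "\<dots> = (\<Sum>k. c k * b (k + r) - c k * b k)"
  proof (rule arg_cong[where f = suminf], rule ext)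
    show "2 * sin (real r * t / 2) * (c k * cos ((real k + 1 / 2) * t)) = c k * b (k + r) - c k * b k" for k
      using arg_cong[OF prod[of k], of "\<lambda>z. c k * z"] by (simp add: algebra_simps)
  qed
  also have "\<dots> = (\<Sum>k. c k * b (k + r)) - (\<Sum>k. c k * b k)"
    using suminf_diff[OF s1 s2] by simp
  also have "(\<Sum>k. c k * b k) = (\<Sum>k. c (k + r) * b (k + r)) + (\<Sum>k<r. c k * b k)"
    by (rule suminf_split_initial_segment[OF s2])
  also have "(\<Sum>k. c k * b (k + r)) - ((\<Sum>k. c (k + r) * b (k + r)) + (\<Sum>k<r. c k * b k))
      = (\<Sum>k. (c k - c (k + r)) * b (k + r)) - (\<Sum>k<r. c k * b k)"
    using suminf_diff[OF s1 s3] by (simp add: algebra_simps)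
  finally have eq: "2 * sin (real r * t / 2) * mean_kernel c t
      = (\<Sum>k. (c k - c (k + r)) * b (k + r)) - (\<Sum>k<r. c k * b k)" .
  have le: "norm ((c k - c (k + r)) * b (k + r)) \<le> \<bar>c k - c (k + r)\<bar>" for k
    using mult_left_mono[OF b1, of "\<bar>c k - c (k + r)\<bar>" "k + r"] by (simp add: abs_mult)
  have sa: "summable (\<lambda>k. norm ((c k - c (k + r)) * b (k + r)))"
    by (rule summable_comparison_test'[OF summable_step_variation[of r], of 0]) (use le in simp)
  have "norm (\<Sum>k. (c k - c (k + r)) * b (k + r)) \<le> step_variation c r"
    unfolding step_variation_def
    by (rule order_trans[OF summable_norm[OF sa] suminf_le[OF le sa summable_step_variation]])
  moreover have "\<bar>\<Sum>k<r. c k * b k\<bar> \<le> step_variation c r"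
  proof -
    have "\<bar>\<Sum>k<r. c k * b k\<bar> \<le> (\<Sum>k<r. \<bar>c k * b k\<bar>)" by (rule sum_abs)
    also have "\<dots> \<le> (\<Sum>k<r. c k)"
      by (intro sum_mono) (auto simp: abs_mult nn mult_left_le b1)
    also have "\<dots> \<le> step_variation c r"
      using block_sum_le_step_variation[of 0 r] by (simp add: atLeast0LessThan)
    finally show ?thesis .
  qed
  ultimately have "\<bar>2 * sin (real r * t / 2) * mean_kernel c t\<bar> \<le> 2 * step_variation c r"
    unfolding eq by simp
  then show ?thesis by (simp add: abs_mult)
qed

end

text \<open>The factor \<open>sin (r t / 2)\<close> vanishes at every point \<open>z = 2 \<pi> m / r\<close>, not only at \<open>0\<close>. Near such a
  \<open>z\<close> one compares with the distance \<open>s = \<bar>t - z\<bar>\<close>: the nearest \<open>z\<close> satisfies \<open>s \<le> t\<close>, so \<open>\<omega> t / t\<close> may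
  be replaced by \<open>2 \<omega> s / s\<close>. Thus each \<open>z\<close> contributes no more than the singularity at \<open>0\<close>, which
  avoids the logarithm that a bounded weight would produce.\<close>

lemma modulus_times_mean_kernel_le:
  fixes c :: "nat \<Rightarrow> real"
  assumes nn: "\<And>k. 0 \<le> c k" and c1: "c sums 1"
    and \<omega>: "modulus_type \<omega>" and r: "1 \<le> r" and t: "0 < t" "t \<le> pi"
    and off: "\<And>m. t \<noteq> 2 * pi * real m / real r"
  shows "\<exists>m\<le>r. \<bar>t - 2 * pi * real m / real r\<bar> \<le> pi \<and>
    \<omega> t / t * \<bar>mean_kernel c t\<bar> \<le>
      2 * (\<omega> \<bar>t - 2 * pi * real m / real r\<bar> / \<bar>t - 2 * pi * real m / real r\<bar>)
        * min 1 (pi * step_variation c r / \<bar>t - 2 * pi * real m / real r\<bar>)"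
proof -
  \<comment> \<open>\<open>y\<close> is \<open>t\<close> in units of the spacing of the zeros, and \<open>m\<close> is \<open>y\<close> rounded.\<close>
  define y where "y = real r * t / (2 * pi)"
  define m where "m = nat \<lfloor>y + 1 / 2\<rfloor>"
  define z where "z = 2 * pi * real m / real r"
  define s where "s = \<bar>t - z\<bar>"
  have r0: "real r \<ge> 1" using r by simp
  have y0: "0 < y" using r0 t by (simp add: y_def)
  have y1: "y \<le> real r / 2" using t r0 by (simp add: y_def field_simps)
  have m: "real m = of_int \<lfloor>y + 1 / 2\<rfloor>" unfolding m_def using y0 by simp
  have ym: "\<bar>y - real m\<bar> \<le> 1 / 2" unfolding m by linarith
  have "real m \<le> real r / 2 + 1 / 2" using ym y1 by linarith
  then have mr: "m \<le> r" using r0 by linarith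
  have tz: "t - z = 2 * pi / real r * (y - real m)"
    using r0 by (simp add: z_def y_def field_simps)
  have s_eq: "s = 2 * pi / real r * \<bar>y - real m\<bar>"
    unfolding s_def tz using r0 by (simp add: abs_mult)
  have s_le: "s \<le> pi / real r"
    using mult_left_mono[OF ym, of "2 * pi / real r"] r0 unfolding s_eq by simp
  have s_pos: "0 < s" using off[of m] by (simp add: s_def z_def)
  have s_t: "s \<le> t"
  proof (cases "m = 0")
    case True
    then show ?thesis using t by (simp add: s_def z_def)
  next
    case False
    then have "real m \<ge> 1" by simp
    then have "z \<ge> 2 * pi / real r"
      unfolding z_def using r0 by (simp add: divide_simps)
    moreover have "t \<ge> z - s" unfolding s_def by linarith
    moreover have "2 * pi / real r = pi / real r + pi / real r" by simp
    ultimately show ?thesis using s_le by linarith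
  qed
  have s_pi: "s \<le> pi" using s_t t by linarith
  define V where "V = step_variation c r"
  have V0: "0 \<le> V" unfolding V_def by (rule step_variation_nonneg[OF nn c1])
  have K1: "\<bar>mean_kernel c t\<bar> \<le> 1" by (rule abs_mean_kernel_le_1[OF nn c1])
  have "real r * t / 2 = pi * (y - real m) + real m * pi"
    by (simp add: y_def algebra_simps)
  then have sin_eq: "\<bar>sin (real r * t / 2)\<bar> = \<bar>sin (pi * (y - real m))\<bar>"
    by (simp only: sin_add sin_npi cos_npi) (simp add: abs_mult)
  have "\<bar>pi * (y - real m)\<bar> \<le> pi / 2"
    using mult_left_mono[OF ym, of pi] by (simp add: abs_mult)
  then have "2 * \<bar>pi * (y - real m)\<bar> / pi \<le> \<bar>sin (real r * t / 2)\<bar>"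
    unfolding sin_eq by (rule abs_sin_ge_linear)
  moreover have "2 * \<bar>pi * (y - real m)\<bar> / pi = real r * s / pi"
    unfolding s_eq abs_mult using r0 by simp
  ultimately have sin_ge: "s / pi \<le> \<bar>sin (real r * t / 2)\<bar>"
    using mult_right_mono[OF r0, of "s / pi"] s_pos by simp
  have "s / pi * \<bar>mean_kernel c t\<bar> \<le> \<bar>sin (real r * t / 2)\<bar> * \<bar>mean_kernel c t\<bar>"
    by (intro mult_right_mono sin_ge) simp
  also have "\<dots> \<le> V"
    using sin_mult_mean_kernel_le[OF nn c1, of r t] by (simp add: V_def abs_mult)
  finally have "\<bar>mean_kernel c t\<bar> \<le> pi * V / s"
    using s_pos by (simp add: field_simps)
  with K1 have K: "\<bar>mean_kernel c t\<bar> \<le> min 1 (pi * V / s)" by simp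
  have "\<omega> t / t * \<bar>mean_kernel c t\<bar> \<le> 2 * (\<omega> s / s) * min 1 (pi * V / s)"
    using modulus_quotient[OF \<omega> s_pos s_t t(2)] K modulus_nonneg[OF \<omega>, of s] s_pos s_pi V0
    by (intro mult_mono) auto
  then show ?thesis
    using mr s_pi unfolding s_def z_def V_def by (intro exI[of _ m]) auto
qed

section \<open>The growth conditions on the majorant\<close>

lemma lebesgue_set_integral_eq_lborel:
  fixes g :: "real \<Rightarrow> real"
  assumes "set_integrable lborel A g" and "A \<in> sets borel"
  shows "(LINT s:A|lebesgue. g s) = (LINT s:A|lborel. g s)"
  unfolding set_lebesgue_integral_def
  by (rule integral_completion) (use assms in \<open>auto simp: set_integrable_def\<close>)

lemma nn_set_integral_eq_set_integral:
  fixes g :: "real \<Rightarrow> real"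
  assumes "set_integrable M A g" and "\<And>s. s \<in> A \<Longrightarrow> 0 \<le> g s"
  shows "(\<integral>\<^sup>+s\<in>A. ennreal (g s) \<partial>M) = ennreal (LINT s:A|M. g s)"
proof -
  have "(\<integral>\<^sup>+s\<in>A. ennreal (g s) \<partial>M) = (\<integral>\<^sup>+s. ennreal (indicator A s *\<^sub>R g s) \<partial>M)"
    by (intro nn_integral_cong) (auto simp: indicator_def)
  also have "\<dots> = ennreal (\<integral>s. indicator A s *\<^sub>R g s \<partial>M)"
    using assms unfolding set_integrable_def
    by (intro nn_integral_eq_integral) (auto simp: indicator_def)
  finally show ?thesis by (simp add: set_lebesgue_integral_def)
qed

text \<open>The growth conditions on \<open>H\<close> give a Dini-type estimate for \<open>\<omega>\<close>: integrating the tail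
  \<open>F t = \<integral> \<omega> s / s\<^sup>2 ds\<close> (from \<open>t\<close> to \<open>\<pi>\<close>) over \<open>(0, u]\<close> and exchanging the integrals leaves at least
  \<open>\<integral> \<omega> s / s ds\<close> (from \<open>0\<close> to \<open>u\<close>), while \<open>F = O(H)\<close> and the mean of \<open>H\<close> is \<open>O(H u)\<close>.\<close>

lemma dini_bounds:
  fixes \<omega> H :: "real \<Rightarrow> real"
  assumes \<omega>: "modulus_type \<omega>" and [measurable]: "\<omega> \<in> borel_measurable borel"
    and H0: "\<forall>u\<in>{0<..pi}. 0 \<le> H u"
    and H_int: "set_integrable lebesgue {0<..pi} H"
    and tail: "(\<lambda>u. LINT t:{u..pi}|lebesgue. \<omega> t / t ^ 2) \<in> O[principal {0<..pi}](H)"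
    and mean: "(\<lambda>u. LINT t:{0<..u}|lebesgue. H t) \<in> O[principal {0<..pi}](\<lambda>u. u * H u)"
  obtains C where "0 < C"
    and "\<And>u. 0 < u \<Longrightarrow> u \<le> pi \<Longrightarrow> (\<integral>\<^sup>+s\<in>{0<..u}. ennreal (\<omega> s / s) \<partial>lborel) \<le> ennreal (C * (u * H u))"
    and "\<And>u. 0 < u \<Longrightarrow> u \<le> pi \<Longrightarrow> (\<integral>\<^sup>+s\<in>{u..pi}. ennreal (\<omega> s / s ^ 2) \<partial>lborel) \<le> ennreal (C * H u)"
proof -
  define F where "F u = (\<integral>\<^sup>+s\<in>{u..pi}. ennreal (\<omega> s / s ^ 2) \<partial>lborel)" for u
  obtain c1 where c1: "c1 > 0"
    "\<And>u. 0 < u \<Longrightarrow> u \<le> pi \<Longrightarrow> \<bar>LINT t:{u..pi}|lebesgue. \<omega> t / t ^ 2\<bar> \<le> c1 * \<bar>H u\<bar>"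
    using tail unfolding bigo_def eventually_principal by auto
  obtain c2 where c2: "c2 > 0"
    "\<And>u. 0 < u \<Longrightarrow> u \<le> pi \<Longrightarrow> \<bar>LINT t:{0<..u}|lebesgue. H t\<bar> \<le> c2 * \<bar>u * H u\<bar>"
    using mean unfolding bigo_def eventually_principal by auto
  have \<omega>0: "0 \<le> \<omega> s" if "0 \<le> s" "s \<le> pi" for s
    using modulus_nonneg[OF \<omega>, of s] that by linarith
  have F_le: "F u \<le> ennreal (c1 * H u)" if u: "0 < u" "u \<le> pi" for u
  proof -
    have "continuous_on {u..pi} (\<lambda>s. \<omega> s / s ^ 2)"
      using \<omega> u unfolding modulus_type_def
      by (intro continuous_intros) (auto intro: continuous_on_subset)
    then have int: "set_integrable lborel {u..pi} (\<lambda>s. \<omega> s / s ^ 2)"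
      by (rule borel_integrable_atLeastAtMost')
    have "F u = ennreal (LINT s:{u..pi}|lborel. \<omega> s / s ^ 2)"
      unfolding F_def by (rule nn_set_integral_eq_set_integral[OF int]) (use \<omega>0 u in auto)
    also have "(LINT s:{u..pi}|lborel. \<omega> s / s ^ 2) = (LINT s:{u..pi}|lebesgue. \<omega> s / s ^ 2)"
      by (simp add: lebesgue_set_integral_eq_lborel[OF int])
    also have "ennreal \<dots> \<le> ennreal (c1 * H u)"
      using c1(2)[OF u] H0 u by (intro ennreal_leI) auto
    finally show ?thesis .
  qed
  have near: "(\<integral>\<^sup>+s\<in>{0<..u}. ennreal (\<omega> s / s) \<partial>lborel) \<le> ennreal (c1 * c2 * (u * H u))"
    if u: "0 < u" "u \<le> pi" for u
  proof -
    have H_int': "set_integrable lebesgue {0<..u} H"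
      by (rule set_integrable_subset[OF H_int]) (use u in auto)
    let ?g = "\<lambda>t s. ennreal (\<omega> s / s ^ 2) * indicator {t..pi} s * indicator {0<..u} t"
    have "(\<integral>\<^sup>+s\<in>{0<..u}. ennreal (\<omega> s / s) \<partial>lborel)
        \<le> (\<integral>\<^sup>+s. (\<integral>\<^sup>+t. ?g t s \<partial>lborel) \<partial>lborel)"
    proof (rule nn_integral_mono)
      fix s :: real
      show "ennreal (\<omega> s / s) * indicator {0<..u} s \<le> (\<integral>\<^sup>+t. ?g t s \<partial>lborel)"
      proof (cases "s \<in> {0<..u}")
        case True
        then have s: "0 < s" "s \<le> u" by auto
        have "ennreal (\<omega> s / s) = ennreal (\<omega> s / s ^ 2) * ennreal s"
          using s u \<omega>0[of s] by (simp add: ennreal_mult[symmetric] power2_eq_square)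
        also have "\<dots> = (\<integral>\<^sup>+t. ennreal (\<omega> s / s ^ 2) * indicator {0<..s} t \<partial>lborel)"
          using s by (simp add: nn_integral_cmult_indicator)
        also have "\<dots> \<le> (\<integral>\<^sup>+t. ?g t s \<partial>lborel)"
          using s u by (intro nn_integral_mono) (auto simp: indicator_def)
        finally show ?thesis using True by simp
      qed simp
    qed
    also have "\<dots> = (\<integral>\<^sup>+t. (\<integral>\<^sup>+s. ?g t s \<partial>lborel) \<partial>lborel)"
      by (rule lborel_pair.Fubini')
        (unfold indicator_def of_bool_def atLeastAtMost_iff greaterThanAtMost_iff, measurable)
    also have "\<dots> = (\<integral>\<^sup>+t\<in>{0<..u}. F t \<partial>lborel)"
      unfolding F_def by (intro nn_integral_cong) (simp add: nn_integral_multc)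
    also have "\<dots> = (\<integral>\<^sup>+t\<in>{0<..u}. F t \<partial>lebesgue)"
      by (simp add: nn_integral_completion)
    also have "\<dots> \<le> (\<integral>\<^sup>+t\<in>{0<..u}. ennreal (c1 * H t) \<partial>lebesgue)"
      using F_le u by (intro nn_integral_mono) (auto simp: indicator_def)
    also have "\<dots> = ennreal (LINT t:{0<..u}|lebesgue. c1 * H t)"
      using H_int' H0 c1(1) u by (intro nn_set_integral_eq_set_integral) auto
    also have "\<dots> \<le> ennreal (c1 * c2 * (u * H u))"
      using c2(2)[OF u] c1(1) H0 u by (intro ennreal_leI) (auto simp: mult.assoc)
    finally show ?thesis .
  qed
  show ?thesis
  proof (rule that[of "c1 * c2 + c1"])
    show "0 < c1 * c2 + c1" using c1(1) c2(1) by (simp add: add_pos_pos)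
    fix u assume u: "0 < u" "u \<le> pi"
    then have "0 \<le> H u" using H0 by auto
    have "c1 * c2 * (u * H u) \<le> (c1 * c2 + c1) * (u * H u)"
      and "c1 * H u \<le> (c1 * c2 + c1) * H u"
      by (rule mult_right_mono; use c1(1) c2(1) u \<open>0 \<le> H u\<close> in simp)+
    then show "(\<integral>\<^sup>+s\<in>{0<..u}. ennreal (\<omega> s / s) \<partial>lborel) \<le> ennreal ((c1 * c2 + c1) * (u * H u))"
      and "(\<integral>\<^sup>+s\<in>{u..pi}. ennreal (\<omega> s / s ^ 2) \<partial>lborel) \<le> ennreal ((c1 * c2 + c1) * H u)"
      using near[OF u] F_le[OF u] unfolding F_def by (auto intro: order_trans ennreal_leI)
  qed
qed

section \<open>The kernel integrated against the modulus\<close>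

lemma nn_integral_reflect:
  assumes [measurable]: "g \<in> borel_measurable (borel :: real measure)"
  shows "(\<integral>\<^sup>+t. g (z - t) \<partial>lborel) = integral\<^sup>N lborel g"
  using nn_integral_real_affine[OF assms, of "-1" z] by simp

lemma nn_integral_translate:
  assumes [measurable]: "g \<in> borel_measurable (borel :: real measure)"
  shows "(\<integral>\<^sup>+t. g (t - z) \<partial>lborel) = integral\<^sup>N lborel g"
  using nn_integral_real_affine[OF assms, of 1 "-z"] by simp

lemma mean_kernel_measurable [measurable]: "mean_kernel c \<in> borel_measurable borel"
  unfolding mean_kernel_def by measurable

text \<open>The pointwise estimate bounds the integrand by translates and reflections of one function
  \<open>\<gamma>\<close> with a singularity at \<open>0\<close>, two for each of the \<open>r + 1\<close> zeros. The integral of \<open>\<gamma>\<close> is split at \<open>h\<close>,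
  where the bound \<open>1\<close> for the averaged cosine gives way to the bound by the variation.\<close>

lemma modulus_kernel_integral_le:
  fixes c :: "nat \<Rightarrow> real"
  assumes nn: "\<And>k. 0 \<le> c k" and c1: "c sums 1"
    and \<omega>: "modulus_type \<omega>" and [measurable]: "\<omega> \<in> borel_measurable borel"
    and r: "1 \<le> r" and h: "0 < h" "h \<le> pi"
    and near: "(\<integral>\<^sup>+s\<in>{0<..h}. ennreal (\<omega> s / s) \<partial>lborel) \<le> ennreal P"
    and far: "(\<integral>\<^sup>+s\<in>{h..pi}. ennreal (\<omega> s / s ^ 2) \<partial>lborel) \<le> ennreal R"
    and PR: "0 \<le> P" "0 \<le> R"
  shows "(\<integral>\<^sup>+t\<in>{0<..pi}. ennreal (\<omega> t / t * \<bar>mean_kernel c t\<bar>) \<partial>lborel)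
    \<le> ennreal (4 * (real r + 1) * (P + pi * step_variation c r * R))"
proof -
  define V where "V = step_variation c r"
  have V0: "0 \<le> V" unfolding V_def by (rule step_variation_nonneg[OF nn c1])
  define z where "z m = 2 * pi * real m / real r" for m :: nat
  define \<gamma> where "\<gamma> s = ennreal (2 * (\<omega> s / s) * min 1 (pi * V / s)) * indicator {0<..pi} s" for s
  have [measurable]: "\<gamma> \<in> borel_measurable borel" unfolding \<gamma>_def by measurable
  have \<omega>0: "0 \<le> \<omega> s" if "0 \<le> s" "s \<le> pi" for s
    using modulus_nonneg[OF \<omega>, of s] that by linarith
  have "integral\<^sup>N lborel \<gamma> \<le> (\<integral>\<^sup>+s. 2 * (ennreal (\<omega> s / s) * indicator {0<..h} s)
      + ennreal (2 * (pi * V)) * (ennreal (\<omega> s / s ^ 2) * indicator {h..pi} s) \<partial>lborel)"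
  proof (rule nn_integral_mono)
    fix s :: real
    show "\<gamma> s \<le> 2 * (ennreal (\<omega> s / s) * indicator {0<..h} s)
      + ennreal (2 * (pi * V)) * (ennreal (\<omega> s / s ^ 2) * indicator {h..pi} s)"
    proof (cases "s \<in> {0<..pi}")
      case True
      then have s: "0 < s" "s \<le> pi" by auto
      have q: "0 \<le> \<omega> s / s" using \<omega>0[of s] s by simp
      show ?thesis
      proof (cases "s \<le> h")
        case le: True
        have "2 * (\<omega> s / s) * min 1 (pi * V / s) \<le> 2 * (\<omega> s / s)"
          using mult_left_mono[of "min 1 (pi * V / s)" 1 "2 * (\<omega> s / s)"] q by simp
        then have "\<gamma> s \<le> 2 * ennreal (\<omega> s / s)"
          using s q unfolding \<gamma>_def by (simp add: ennreal_mult'[symmetric] ennreal_leI flip: ennreal_numeral)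
        then show ?thesis using le s by (simp add: add_increasing2)
      next
        case False
        have "2 * (\<omega> s / s) * min 1 (pi * V / s) \<le> 2 * (\<omega> s / s) * (pi * V / s)"
          using q by (intro mult_left_mono) auto
        also have "\<dots> = 2 * (pi * V) * (\<omega> s / s ^ 2)" by (simp add: power2_eq_square)
        finally have "\<gamma> s \<le> ennreal (2 * (pi * V)) * ennreal (\<omega> s / s ^ 2)"
          using s V0 unfolding \<gamma>_def by (simp add: ennreal_mult'[symmetric] ennreal_leI)
        then show ?thesis using False s by simp
      qed
    qed (simp add: \<gamma>_def)
  qed
  also have "\<dots> = 2 * (\<integral>\<^sup>+s\<in>{0<..h}. ennreal (\<omega> s / s) \<partial>lborel)
      + ennreal (2 * (pi * V)) * (\<integral>\<^sup>+s\<in>{h..pi}. ennreal (\<omega> s / s ^ 2) \<partial>lborel)"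
    by (simp add: nn_integral_add nn_integral_cmult)
  also have "\<dots> \<le> 2 * ennreal P + ennreal (2 * (pi * V)) * ennreal R"
    by (intro add_mono mult_left_mono near far) auto
  also have "\<dots> = ennreal (2 * (P + pi * V * R))"
    using PR V0 by (simp add: ennreal_plus[symmetric] ennreal_mult'[symmetric] algebra_simps
        flip: ennreal_numeral del: ennreal_plus)
  finally have \<gamma>_le: "integral\<^sup>N lborel \<gamma> \<le> ennreal (2 * (P + pi * V * R))" .
  have "AE t in lborel. t \<notin> range z"
    by (intro AE_not_in countable_imp_null_set_lborel) simp
  then have "(\<integral>\<^sup>+t\<in>{0<..pi}. ennreal (\<omega> t / t * \<bar>mean_kernel c t\<bar>) \<partial>lborel)
      \<le> (\<integral>\<^sup>+t. (\<Sum>m\<le>r. \<gamma> (t - z m) + \<gamma> (z m - t)) \<partial>lborel)"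
  proof (intro nn_integral_mono_AE, elim eventually_mono)
    fix t assume t: "t \<notin> range z"
    show "ennreal (\<omega> t / t * \<bar>mean_kernel c t\<bar>) * indicator {0<..pi} t
      \<le> (\<Sum>m\<le>r. \<gamma> (t - z m) + \<gamma> (z m - t))"
    proof (cases "t \<in> {0<..pi}")
      case True
      with modulus_times_mean_kernel_le[OF nn c1 \<omega> r, of t] t
      obtain m where m: "m \<le> r" "\<bar>t - z m\<bar> \<le> pi"
        "\<omega> t / t * \<bar>mean_kernel c t\<bar>
          \<le> 2 * (\<omega> \<bar>t - z m\<bar> / \<bar>t - z m\<bar>) * min 1 (pi * V / \<bar>t - z m\<bar>)"
        unfolding z_def V_def by auto
      have "0 < \<bar>t - z m\<bar>" using t by auto
      then have "ennreal (\<omega> t / t * \<bar>mean_kernel c t\<bar>) \<le> \<gamma> \<bar>t - z m\<bar>"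
        using m unfolding \<gamma>_def by (simp add: ennreal_leI)
      also have "\<dots> \<le> \<gamma> (t - z m) + \<gamma> (z m - t)"
        by (cases "t \<ge> z m") (simp_all add: add_increasing add_increasing2)
      also have "\<dots> \<le> (\<Sum>m\<le>r. \<gamma> (t - z m) + \<gamma> (z m - t))"
        using m(1) by (intro member_le_sum) auto
      finally show ?thesis using True by simp
    qed simp
  qed
  also have "\<dots> = (\<Sum>m\<le>r. 2 * integral\<^sup>N lborel \<gamma>)"
    by (subst nn_integral_sum) (auto simp: nn_integral_add nn_integral_reflect nn_integral_translate mult_2)
  also have "\<dots> \<le> (\<Sum>m\<le>r. 2 * ennreal (2 * (P + pi * V * R)))"
    by (intro sum_mono mult_left_mono \<gamma>_le) auto
  also have "\<dots> = ennreal (4 * (real r + 1) * (P + pi * V * R))"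
    using PR V0 by (simp add: ennreal_mult'[symmetric] ennreal_of_nat_eq_real_of_nat algebra_simps
        flip: ennreal_numeral)
  finally show ?thesis unfolding V_def .
qed

section \<open>Integrals of periodic functions\<close>

lemma periodic_int:
  assumes "\<And>x. g (x + 2 * pi) = g x"
  shows "g (x + 2 * pi * of_int j) = g x"
proof (induction j arbitrary: x rule: int_induct[of _ 0])
  case (step1 i)
  have "g (x + 2 * pi * of_int (i + 1)) = g (x + 2 * pi * of_int i + 2 * pi)"
    by (simp add: algebra_simps)
  then show ?case using assms step1 by simp
next
  case (step2 i)
  have "g (x + 2 * pi * of_int i) = g (x + 2 * pi * of_int (i - 1) + 2 * pi)"
    by (simp add: algebra_simps)
  then show ?case using assms step2 by simp
qed simp

lemma ex_shift_into_Q: "\<exists>j::int. x - 2 * pi * of_int j \<in> Q"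
proof
  define j where "j = \<lfloor>(x + pi) / (2 * pi)\<rfloor>"
  have "of_int j \<le> (x + pi) / (2 * pi)" "(x + pi) / (2 * pi) \<le> of_int j + 1"
    unfolding j_def by linarith+
  then have "2 * pi * of_int j \<le> x + pi" "x + pi \<le> 2 * pi * of_int j + 2 * pi"
    by (simp_all add: field_simps)
  then show "x - 2 * pi * of_int \<lfloor>(x + pi) / (2 * pi)\<rfloor> \<in> Q" by (auto simp: j_def)
qed

text \<open>Enclosing the exceptional set in a Borel null set makes the affine invariance of null sets
  applicable to predicates that are not Borel.\<close>

lemma AE_lborel_affine:
  fixes P :: "real \<Rightarrow> bool"
  assumes "AE x in lborel. P x" "c \<noteq> 0"
  shows "AE x in lborel. P (t + c * x)"
proof -
  obtain N where N: "N \<in> null_sets lborel" "{x. \<not> P x} \<subseteq> N"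
    using assms(1) unfolding eventually_ae_filter by auto
  have [measurable]: "N \<in> sets borel" using N(1) by auto
  have "AE x in lborel. x \<notin> N" using N(1) by (rule AE_not_in)
  then have "AE x in lborel. t + c * x \<notin> N"
    by (rule AE_borel_affine[OF assms(2), rotated]) measurable
  then show ?thesis by eventually_elim (use N(2) in blast)
qed

lemma periodic_AE:
  assumes per: "\<And>x. P (x + 2 * pi) = P x" and ae: "AE x in lborel. x \<in> Q \<longrightarrow> P x"
  shows "AE x in lborel. P x"
proof -
  have "AE x in lborel. - 2 * pi * of_int j + 1 * x \<in> Q \<longrightarrow> P (- 2 * pi * of_int j + 1 * x)" for j :: int
    by (rule AE_lborel_affine[OF ae]) simp
  then have "AE x in lborel. \<forall>j::int. - 2 * pi * of_int j + 1 * x \<in> Q \<longrightarrow> P (- 2 * pi * of_int j + 1 * x)"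
    by (simp add: AE_all_countable)
  then show ?thesis
  proof eventually_elim
    case (elim x)
    obtain j :: int where "x - 2 * pi * of_int j \<in> Q" using ex_shift_into_Q by blast
    then have j: "- 2 * pi * of_int j + 1 * x \<in> Q" by (simp only: mult_1 minus_mult_left[symmetric]) simp
    then have "P (- 2 * pi * of_int j + 1 * x)" using elim by blast
    then show "P x" using periodic_int[of P "- 2 * pi * of_int j + 1 * x" j, OF per] by simp
  qed
qed

text \<open>After reduction to a shift \<open>0 \<le> t \<le> 2\<pi>\<close>, the piece of \<open>[t - \<pi>, t + \<pi>]\<close> beyond \<open>\<pi>\<close> is moved back by one
  period.\<close>

lemma nn_integral_periodic_translate:
  fixes g :: "real \<Rightarrow> ennreal"
  assumes [measurable]: "g \<in> borel_measurable borel" and per: "\<And>x. g (x + 2 * pi) = g x"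
  shows "(\<integral>\<^sup>+x\<in>Q. g (x + t) \<partial>lborel) = (\<integral>\<^sup>+x\<in>Q. g x \<partial>lborel)"
proof -
  have base: "(\<integral>\<^sup>+x\<in>Q. g (x + t) \<partial>lborel) = (\<integral>\<^sup>+x\<in>Q. g x \<partial>lborel)" if t: "0 \<le> t" "t \<le> 2 * pi" for t
  proof -
    have "(\<integral>\<^sup>+x\<in>Q. g (x + t) \<partial>lborel) = (\<integral>\<^sup>+y. g (y - t + t) * indicator Q (y - t) \<partial>lborel)"
      by (rule nn_integral_translate[symmetric]) measurable
    also have "\<dots> = (\<integral>\<^sup>+y. g y * indicator {t - pi..t + pi} y \<partial>lborel)"
      by (intro nn_integral_cong) (auto simp: indicator_def)
    also have "\<dots> = (\<integral>\<^sup>+y. g y * indicator {t - pi..pi} y + g y * indicator {pi<..t + pi} y \<partial>lborel)"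
      using t by (intro nn_integral_cong) (auto simp: indicator_def)
    also have "\<dots> = (\<integral>\<^sup>+y. g y * indicator {t - pi..pi} y \<partial>lborel) + (\<integral>\<^sup>+y. g y * indicator {pi<..t + pi} y \<partial>lborel)"
      by (rule nn_integral_add) measurable
    also have "(\<integral>\<^sup>+y. g y * indicator {pi<..t + pi} y \<partial>lborel) = (\<integral>\<^sup>+y. g y * indicator {-pi<..t - pi} y \<partial>lborel)"
    proof -
      have "(\<integral>\<^sup>+y. g y * indicator {-pi<..t - pi} y \<partial>lborel)
          = (\<integral>\<^sup>+y. g (y - 2 * pi) * indicator {-pi<..t - pi} (y - 2 * pi) \<partial>lborel)"
        by (rule nn_integral_translate[symmetric]) measurable
      also have "\<dots> = (\<integral>\<^sup>+y. g y * indicator {pi<..t + pi} y \<partial>lborel)"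
        using per[of "y - 2 * pi" for y] by (intro nn_integral_cong) (auto simp: indicator_def)
      finally show ?thesis by simp
    qed
    also have "(\<integral>\<^sup>+y. g y * indicator {t - pi..pi} y \<partial>lborel) + \<dots>
        = (\<integral>\<^sup>+y. g y * indicator {t - pi..pi} y + g y * indicator {-pi<..t - pi} y \<partial>lborel)"
      by (rule nn_integral_add[symmetric]) measurable
    also have "\<dots> = (\<integral>\<^sup>+y\<in>Q. g y \<partial>lborel)"
    proof (rule nn_integral_cong_AE)
      have "AE y in lborel. y \<notin> {t - pi, -pi}"
        by (intro AE_not_in countable_imp_null_set_lborel) simp
      then show "AE y in lborel. g y * indicator {t - pi..pi} y + g y * indicator {-pi<..t - pi} y
          = g y * indicator Q y"
        by eventually_elim (use t in \<open>auto simp: indicator_def\<close>)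
    qed
    finally show ?thesis .
  qed
  obtain j :: int where j: "(t - pi) - 2 * pi * of_int j \<in> Q" using ex_shift_into_Q by blast
  have "g (x + t) = g (x + (t - 2 * pi * of_int j))" for x
    using periodic_int[of g "x + (t - 2 * pi * of_int j)" j, OF per] by simp
  then show ?thesis using base[of "t - 2 * pi * of_int j"] j by simp
qed

lemma nn_integral_periodic_reflect:
  fixes g :: "real \<Rightarrow> ennreal"
  assumes [measurable]: "g \<in> borel_measurable borel" and per: "\<And>x. g (x + 2 * pi) = g x"
  shows "(\<integral>\<^sup>+x\<in>Q. g (t - x) \<partial>lborel) = (\<integral>\<^sup>+x\<in>Q. g x \<partial>lborel)"
proof -
  have "(\<integral>\<^sup>+x\<in>Q. g (t - x) \<partial>lborel) = (\<integral>\<^sup>+x. g (t - (0 - x)) * indicator Q (0 - x) \<partial>lborel)"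
    by (rule nn_integral_reflect[symmetric]) measurable
  also have "\<dots> = (\<integral>\<^sup>+x\<in>Q. g (x + t) \<partial>lborel)"
    by (intro nn_integral_cong) (auto simp: indicator_def add.commute)
  finally show ?thesis using nn_integral_periodic_translate[OF assms] by simp
qed

lemma set_integrable_iff_nn_integral_finite:
  fixes g :: "real \<Rightarrow> real"
  assumes "g \<in> borel_measurable M" "A \<in> sets M"
  shows "set_integrable M A g \<longleftrightarrow> (\<integral>\<^sup>+x\<in>A. ennreal \<bar>g x\<bar> \<partial>M) < \<infinity>"
proof -
  have "(\<integral>\<^sup>+x. ennreal (norm (indicator A x *\<^sub>R g x)) \<partial>M) = (\<integral>\<^sup>+x\<in>A. ennreal \<bar>g x\<bar> \<partial>M)"
    by (intro nn_integral_cong) (auto simp: indicator_def)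
  then show ?thesis
    using assms by (simp add: set_integrable_def integrable_iff_bounded)
qed

lemma set_integral_eq_nn_diff:
  fixes g :: "real \<Rightarrow> real"
  assumes "set_integrable M A g"
  shows "(LINT x:A|M. g x) = enn2real (\<integral>\<^sup>+x\<in>A. ennreal (g x) \<partial>M) - enn2real (\<integral>\<^sup>+x\<in>A. ennreal (- g x) \<partial>M)"
proof -
  have "(\<integral>\<^sup>+x. ennreal (indicator A x *\<^sub>R g x) \<partial>M) = (\<integral>\<^sup>+x\<in>A. ennreal (g x) \<partial>M)"
    "(\<integral>\<^sup>+x. ennreal (- (indicator A x *\<^sub>R g x)) \<partial>M) = (\<integral>\<^sup>+x\<in>A. ennreal (- g x) \<partial>M)"
    by (intro nn_integral_cong; auto simp: indicator_def)+
  then show ?thesis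
    using assms by (simp add: set_lebesgue_integral_def set_integrable_def real_lebesgue_integral_def)
qed

lemma set_integral_periodic_reflect:
  fixes g :: "real \<Rightarrow> real"
  assumes [measurable]: "g \<in> borel_measurable borel" and per: "\<And>x. g (x + 2 * pi) = g x"
    and int: "set_integrable lborel Q g"
  shows "set_integrable lborel Q (\<lambda>x. g (t - x))"
    and "(LINT x:Q|lborel. g (t - x)) = (LINT x:Q|lborel. g x)"
proof -
  have "(\<integral>\<^sup>+x\<in>Q. ennreal \<bar>g (t - x)\<bar> \<partial>lborel) = (\<integral>\<^sup>+x\<in>Q. ennreal \<bar>g x\<bar> \<partial>lborel)"
    by (rule nn_integral_periodic_reflect) (auto simp: per)
  then show int': "set_integrable lborel Q (\<lambda>x. g (t - x))"
    using int by (simp add: set_integrable_iff_nn_integral_finite)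
  have "(\<integral>\<^sup>+x\<in>Q. ennreal (g (t - x)) \<partial>lborel) = (\<integral>\<^sup>+x\<in>Q. ennreal (g x) \<partial>lborel)"
    "(\<integral>\<^sup>+x\<in>Q. ennreal (- g (t - x)) \<partial>lborel) = (\<integral>\<^sup>+x\<in>Q. ennreal (- g x) \<partial>lborel)"
    by (rule nn_integral_periodic_reflect; auto simp: per)+
  then show "(LINT x:Q|lborel. g (t - x)) = (LINT x:Q|lborel. g x)"
    by (simp only: set_integral_eq_nn_diff[OF int] set_integral_eq_nn_diff[OF int'])
qed

section \<open>The integral inequality of Minkowski\<close>

text \<open>Young's inequality for \<open>F\<^sup>p (l N)\<^bsup>1 - p\<^esup>\<close> and \<open>l N\<close>. The weight \<open>N\<^bsup>1 - p\<^esup>\<close> is the one that compensates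
  slices of \<open>p\<close>-norm \<open>N\<close>, and \<open>l\<close> is a free parameter.\<close>

lemma Young_weighted:
  fixes F N l p :: real
  assumes p: "1 \<le> p" and F: "0 \<le> F" and N: "0 < N" and l: "0 < l"
  shows "F \<le> l powr (1 - p) / p * (F powr p * N powr (1 - p)) + (1 - 1 / p) * l * N"
proof (cases "F = 0")
  case True
  then show ?thesis using assms by simp
next
  case False
  define A where "A = F powr p * (l * N) powr (1 - p)"
  have A: "0 < A" and lN: "0 < l * N" using False assms by (simp_all add: A_def)
  have "A powr (1 / p) * (l * N) powr (1 - 1 / p) = F powr (p * (1 / p)) * (l * N) powr ((1 - p) * (1 / p) + (1 - 1 / p))"
    using lN F unfolding A_def by (simp add: powr_mult powr_powr powr_add)
  also have "\<dots> = F"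
    using p False F l N by (simp add: diff_divide_distrib)
  finally have "F \<le> 1 / p * A + (1 - 1 / p) * (l * N)"
    using Youngs_inequality_0[of "1 / p" "1 - 1 / p" A "l * N"] A lN p by simp
  also have "A = l powr (1 - p) * (F powr p * N powr (1 - p))"
    using l N by (simp add: A_def powr_mult)
  finally show ?thesis by (simp add: mult.assoc)
qed

text \<open>The optimal parameter is \<open>l = i / W\<close>.\<close>

lemma Young_optimised:
  fixes i j p W :: real
  assumes p: "1 \<le> p" and i: "0 \<le> i" and W: "0 < W" and j: "0 \<le> j"
    and le: "\<And>l. 0 < l \<Longrightarrow> i \<le> l powr (1 - p) / p * j + (1 - 1 / p) * l * W"
  shows "i powr p \<le> W powr (p - 1) * j"
proof (cases "i = 0")
  case False
  then have i: "0 < i" using i by simp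
  have "i \<le> (i / W) powr (1 - p) / p * j + (1 - 1 / p) * i"
    using le[of "i / W"] i W by simp
  then have "i / p \<le> (i / W) powr (1 - p) / p * j"
    by (simp add: algebra_simps)
  then have "i \<le> (i / W) powr (1 - p) * j"
    using p by (simp add: divide_right_mono field_simps)
  then have "i powr (p - 1) * i \<le> i powr (p - 1) * ((i / W) powr (1 - p) * j)"
    by (rule mult_left_mono) simp
  also have "i powr (p - 1) * ((i / W) powr (1 - p) * j) = W powr (p - 1) * j"
  proof -
    have "i powr (p - 1) * (i / W) powr (1 - p) = W powr (p - 1)"
      using i W by (simp add: powr_divide powr_diff field_simps)
    then show ?thesis by (simp flip: mult.assoc)
  qed
  also have "i powr (p - 1) * i = i powr p"
    using i by (simp add: powr_diff)
  finally show ?thesis .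
qed (use W j in simp)

lemma ennreal_linear_combination:
  assumes "0 \<le> a" "0 \<le> u" "0 \<le> v" "0 \<le> b" "0 \<le> n"
  shows "ennreal (a * (u * v) + b * n) = ennreal a * (ennreal u * ennreal v) + ennreal b * ennreal n"
  using assms by (simp add: ennreal_mult)

text \<open>Integrate the weighted Young inequality over \<open>t\<close> and then choose its parameter for each \<open>x\<close>. With
  \<open>I x\<close> the integral of \<open>F x\<close> and \<open>J x\<close> that of \<open>F\<^sup>p N\<^bsup>1 - p\<^esup>\<close>, this gives \<open>I\<^sup>p \<le> W\<^bsup>p - 1\<^esup> J\<close>, which is Jensen's
  inequality for the measure \<open>N dt / W\<close>; and \<open>\<integral> J \<le> W\<close> by exchanging integrals. The slices with
  \<open>N t = 0\<close>, where the weight degenerates, vanish almost everywhere and are split off as \<open>Z\<close>.\<close>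

lemma (in pair_sigma_finite) Minkowski_integral_inequality:
  fixes F :: "'a \<Rightarrow> 'b \<Rightarrow> real" and N :: "'b \<Rightarrow> real"
  assumes F[measurable]: "case_prod F \<in> borel_measurable (M1 \<Otimes>\<^sub>M M2)"
    and N[measurable]: "N \<in> borel_measurable M2"
    and F0: "\<And>x t. 0 \<le> F x t" and N0: "\<And>t. 0 \<le> N t" and p: "1 \<le> p" and W: "0 < W"
    and slice: "\<And>t. (\<integral>\<^sup>+x. ennreal (F x t powr p) \<partial>M1) \<le> ennreal (N t powr p)"
    and total: "(\<integral>\<^sup>+t. ennreal (N t) \<partial>M2) \<le> ennreal W"
  shows "AE x in M1. (\<integral>\<^sup>+t. ennreal (F x t) \<partial>M2) < \<infinity>"
    and "(\<integral>\<^sup>+x. ennreal (enn2real (\<integral>\<^sup>+t. ennreal (F x t) \<partial>M2) powr p) \<partial>M1) \<le> ennreal (W powr p)"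
proof -
  define I where "I x = (\<integral>\<^sup>+t. ennreal (F x t) \<partial>M2)" for x
  define J where "J x = (\<integral>\<^sup>+t. ennreal (F x t powr p) * ennreal (N t powr (1 - p)) \<partial>M2)" for x
  define Z where "Z x = (\<integral>\<^sup>+t. ennreal (F x t) * indicator {t. N t = 0} t \<partial>M2)" for x
  have [measurable]: "I \<in> borel_measurable M1" "J \<in> borel_measurable M1" "Z \<in> borel_measurable M1"
    unfolding I_def J_def Z_def by measurable
  have [measurable]: "(\<lambda>x. F x t) \<in> borel_measurable M1" if "t \<in> space M2" for t
    using that by measurable
  have "(\<integral>\<^sup>+x. J x \<partial>M1) = (\<integral>\<^sup>+t. (\<integral>\<^sup>+x. ennreal (F x t powr p) * ennreal (N t powr (1 - p)) \<partial>M1) \<partial>M2)"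
    unfolding J_def by (rule Fubini'[symmetric]) measurable
  also have "\<dots> = (\<integral>\<^sup>+t. (\<integral>\<^sup>+x. ennreal (F x t powr p) \<partial>M1) * ennreal (N t powr (1 - p)) \<partial>M2)"
    by (intro nn_integral_cong nn_integral_multc) measurable
  also have "\<dots> \<le> (\<integral>\<^sup>+t. ennreal (N t powr p) * ennreal (N t powr (1 - p)) \<partial>M2)"
    by (intro nn_integral_mono mult_right_mono slice) simp
  also have "\<dots> = (\<integral>\<^sup>+t. ennreal (N t) \<partial>M2)"
  proof (rule nn_integral_cong)
    show "ennreal (N t powr p) * ennreal (N t powr (1 - p)) = ennreal (N t)" for t
      using N0[of t] by (cases "N t = 0") (simp_all flip: ennreal_mult powr_add)
  qed
  finally have J_int: "(\<integral>\<^sup>+x. J x \<partial>M1) \<le> ennreal W" using total by simp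
  then have "AE x in M1. J x \<noteq> \<infinity>"
    by (intro nn_integral_PInf_AE) (auto simp: top_unique)
  moreover have "AE x in M1. Z x = 0"
  proof -
    have "(\<integral>\<^sup>+x. Z x \<partial>M1) = (\<integral>\<^sup>+t. (\<integral>\<^sup>+x. ennreal (F x t) * indicator {t. N t = 0} t \<partial>M1) \<partial>M2)"
      unfolding Z_def by (rule Fubini'[symmetric]) measurable
    also have "\<dots> = (\<integral>\<^sup>+t. 0 \<partial>M2)"
    proof (rule nn_integral_cong)
      fix t assume t: "t \<in> space M2"
      show "(\<integral>\<^sup>+x. ennreal (F x t) * indicator {t. N t = 0} t \<partial>M1) = 0"
      proof (cases "N t = 0")
        case True
        then have "(\<integral>\<^sup>+x. ennreal (F x t powr p) \<partial>M1) = 0" using slice[of t] by simp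
        then have "AE x in M1. ennreal (F x t powr p) = 0"
          using t by (subst (asm) nn_integral_0_iff_AE) auto
        then have "AE x in M1. ennreal (F x t) = 0"
            by eventually_elim (use F0 in \<open>simp add: order_antisym\<close>)
        then have "(\<integral>\<^sup>+x. ennreal (F x t) \<partial>M1) = (\<integral>\<^sup>+x. 0 \<partial>M1)"
            by (rule nn_integral_cong_AE)
          then show ?thesis using True by simp
      qed simp
    qed
    finally have "(\<integral>\<^sup>+x. Z x \<partial>M1) = 0" by simp
    then show ?thesis by (subst (asm) nn_integral_0_iff_AE) auto
  qed
  ultimately have ae: "AE x in M1. I x < \<infinity> \<and> ennreal (enn2real (I x) powr p) \<le> ennreal (W powr (p - 1)) * J x"
    using AE_space
  proof eventually_elim
    case (elim x)
    have [measurable]: "F x \<in> borel_measurable M2" using elim(3) by measurable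
    have le: "I x \<le> ennreal (l powr (1 - p) / p) * J x + ennreal ((1 - 1 / p) * l * W)" if l: "0 < l" for l
    proof -
      have p': "0 \<le> 1 - 1 / p" using p by simp
      have "I x \<le> (\<integral>\<^sup>+t. ennreal (F x t) * indicator {t. N t = 0} t
          + (ennreal (l powr (1 - p) / p) * (ennreal (F x t powr p) * ennreal (N t powr (1 - p)))
          + ennreal ((1 - 1 / p) * l) * ennreal (N t)) \<partial>M2)"
        unfolding I_def
      proof (rule nn_integral_mono)
        fix t
        show "ennreal (F x t) \<le> ennreal (F x t) * indicator {t. N t = 0} t
          + (ennreal (l powr (1 - p) / p) * (ennreal (F x t powr p) * ennreal (N t powr (1 - p)))
          + ennreal ((1 - 1 / p) * l) * ennreal (N t))"
        proof (cases "N t = 0")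
          case False
          then have "0 < N t" using N0[of t] by simp
          then have "ennreal (F x t) \<le> ennreal (l powr (1 - p) / p * (F x t powr p * N t powr (1 - p)) + (1 - 1 / p) * l * N t)"
            by (intro ennreal_leI Young_weighted p F0 l)
          also have "\<dots> = ennreal (l powr (1 - p) / p) * (ennreal (F x t powr p) * ennreal (N t powr (1 - p)))
              + ennreal ((1 - 1 / p) * l) * ennreal (N t)"
            by (rule ennreal_linear_combination) (use p p' l N0 in auto)
          finally show ?thesis using False by simp
        qed simp
      qed
      also have "\<dots> = Z x + (ennreal (l powr (1 - p) / p) * J x
          + ennreal ((1 - 1 / p) * l) * (\<integral>\<^sup>+t. ennreal (N t) \<partial>M2))"
        unfolding Z_def J_def by (simp add: nn_integral_add nn_integral_cmult)
      also have "\<dots> \<le> ennreal (l powr (1 - p) / p) * J x + ennreal ((1 - 1 / p) * l) * ennreal W"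
        using elim(2) by (auto intro!: add_mono mult_left_mono total)
      also have "ennreal ((1 - 1 / p) * l) * ennreal W = ennreal ((1 - 1 / p) * l * W)"
        using p' l W by (simp add: ennreal_mult)
      finally show ?thesis .
    qed
    obtain j where j: "J x = ennreal j" "0 \<le> j" using elim(1) by (cases "J x") auto
    \<comment> \<open>The case \<open>l = 1\<close> shows that \<open>I x\<close> is finite, so that it can serve in the optimal parameter.\<close>
    have fin: "I x < \<infinity>" using le[of 1] j by (simp add: ennreal_mult_less_top top.not_eq_extremum le_less_trans)
    then obtain i where i: "I x = ennreal i" "0 \<le> i" by (cases "I x") auto
    have "i \<le> l powr (1 - p) / p * j + (1 - 1 / p) * l * W" if l: "0 < l" for l
      using le[OF l] i j p l W
      by (simp add: ennreal_mult[symmetric] ennreal_plus[symmetric] del: ennreal_plus)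
    from Young_optimised[OF p i(2) W j(2) this] have "i powr p \<le> W powr (p - 1) * j" .
    then show ?case using fin i j by (simp add: ennreal_mult[symmetric] ennreal_leI)
  qed
  then show "AE x in M1. (\<integral>\<^sup>+t. ennreal (F x t) \<partial>M2) < \<infinity>"
    unfolding I_def by eventually_elim auto
  have "(\<integral>\<^sup>+x. ennreal (enn2real (I x) powr p) \<partial>M1) \<le> (\<integral>\<^sup>+x. ennreal (W powr (p - 1)) * J x \<partial>M1)"
    by (rule nn_integral_mono_AE) (use ae in eventually_elim, auto)
  also have "\<dots> = ennreal (W powr (p - 1)) * (\<integral>\<^sup>+x. J x \<partial>M1)"
    by (rule nn_integral_cmult) measurable
  also have "\<dots> \<le> ennreal (W powr (p - 1)) * ennreal W"
    by (intro mult_left_mono J_int) simp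
  also have "\<dots> = ennreal (W powr p)"
    using W by (simp add: ennreal_mult[symmetric] powr_diff)
  finally show "(\<integral>\<^sup>+x. ennreal (enn2real (\<integral>\<^sup>+t. ennreal (F x t) \<partial>M2) powr p) \<partial>M1) \<le> ennreal (W powr p)"
    unfolding I_def .
qed

section \<open>The norms and the differences of a function\<close>

lemma psi_measurable [measurable (raw)]:
  assumes [measurable]: "f \<in> borel_measurable borel" "u \<in> borel_measurable M" "v \<in> borel_measurable M"
  shows "(\<lambda>z. psi f (u z) (v z)) \<in> borel_measurable M"
  unfolding psi_def by measurable

lemma psi_periodic: "periodic_2pi f \<Longrightarrow> psi f (x + 2 * pi) t = psi f x t"
  unfolding psi_def periodic_2pi_def by (metis add.assoc add.commute add_diff_eq)

lemma set_integral_abs_le_nn: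
  fixes g :: "real \<Rightarrow> real"
  assumes "g \<in> borel_measurable M" "A \<in> sets M" "(\<integral>\<^sup>+t\<in>A. ennreal \<bar>g t\<bar> \<partial>M) < \<infinity>"
  shows "\<bar>LINT t:A|M. g t\<bar> \<le> enn2real (\<integral>\<^sup>+t\<in>A. ennreal \<bar>g t\<bar> \<partial>M)"
proof -
  have int: "set_integrable M A g"
    using assms by (simp add: set_integrable_iff_nn_integral_finite)
  then have "\<bar>LINT t:A|M. g t\<bar> \<le> (LINT t:A|M. \<bar>g t\<bar>)"
    unfolding set_lebesgue_integral_def set_integrable_def
    using integral_norm_bound[of M "\<lambda>x. indicator A x *\<^sub>R g x"]
    by (simp add: abs_mult)
  also have "\<dots> = enn2real (\<integral>\<^sup>+t\<in>A. ennreal \<bar>g t\<bar> \<partial>M)"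
    using nn_set_integral_eq_set_integral[OF set_integrable_abs[OF int]]
      by (simp add: set_lebesgue_integral_def)
  finally show ?thesis .
qed

lemma Lp_carrier_iff:
  assumes "g \<in> borel_measurable lebesgue" "periodic_2pi g"
  shows "g \<in> X_carrier (Lp p) \<longleftrightarrow> (\<integral>\<^sup>+x\<in>Q. ennreal (\<bar>g x\<bar> powr p) \<partial>lborel) < \<infinity>"
  using set_integrable_iff_nn_integral_finite[of "\<lambda>x. \<bar>g x\<bar> powr p" lebesgue Q] assms
  by (simp add: nn_integral_completion)

lemma Lp_norm_powr:
  assumes "g \<in> X_carrier (Lp p)" "1 \<le> p"
  shows "ennreal (X_norm (Lp p) g powr p) = (\<integral>\<^sup>+x\<in>Q. ennreal (\<bar>g x\<bar> powr p) \<partial>lborel)"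
proof -
  have "0 \<le> (LINT t:Q|lebesgue. \<bar>g t\<bar> powr p)"
    unfolding set_lebesgue_integral_def by (rule integral_nonneg_AE) auto
  then have "X_norm (Lp p) g powr p = (LINT t:Q|lebesgue. \<bar>g t\<bar> powr p)"
    using assms(2) by (simp add: powr_powr)
  also have "ennreal \<dots> = (\<integral>\<^sup>+x\<in>Q. ennreal (\<bar>g x\<bar> powr p) \<partial>lebesgue)"
    using assms(1) by (intro nn_set_integral_eq_set_integral[symmetric]) auto
  finally show ?thesis by (simp add: nn_integral_completion)
qed

lemma Lp_norm_le:
  assumes "g \<in> X_carrier (Lp p)" "1 \<le> p" "0 \<le> B"
    and "(\<integral>\<^sup>+x\<in>Q. ennreal (\<bar>g x\<bar> powr p) \<partial>lborel) \<le> ennreal (B powr p)"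
  shows "X_norm (Lp p) g \<le> B"
proof -
  have "X_norm (Lp p) g powr p \<le> B powr p"
    using assms(4) unfolding Lp_norm_powr[OF assms(1,2), symmetric] by simp
  then show ?thesis
    using powr_less_mono2[of p B "X_norm (Lp p) g"] assms(2,3) by linarith
qed

lemma esssup_abs_nonneg:
  fixes g :: "real \<Rightarrow> real"
  assumes "g \<in> borel_measurable lebesgue"
  shows "0 \<le> esssup (restrict_space lebesgue Q) (\<lambda>t. ereal \<bar>g t\<bar>)"
proof -
  have "emeasure (restrict_space lebesgue Q) (space (restrict_space lebesgue Q)) \<noteq> 0"
    by (simp add: emeasure_restrict_space space_restrict_space)
  then have "esssup (restrict_space lebesgue Q) (\<lambda>t. 0 :: ereal) = 0" by (rule esssup_const)
  moreover have "esssup (restrict_space lebesgue Q) (\<lambda>t. 0 :: ereal)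
      \<le> esssup (restrict_space lebesgue Q) (\<lambda>t. ereal \<bar>g t\<bar>)"
    by (rule esssup_mono) auto
  ultimately show ?thesis by simp
qed

lemma Linf_AE_le:
  assumes "g \<in> X_carrier Linf"
  shows "AE x in lborel. \<bar>g x\<bar> \<le> X_norm Linf g"
proof (rule periodic_AE)
  show "(\<bar>g (x + 2 * pi)\<bar> \<le> X_norm Linf g) = (\<bar>g x\<bar> \<le> X_norm Linf g)" for x
    using assms by (simp add: periodic_2pi_def)
  let ?e = "esssup (restrict_space lebesgue Q) (\<lambda>t. ereal \<bar>g t\<bar>)"
  have e: "?e < \<infinity>" "0 \<le> ?e" using assms esssup_abs_nonneg by auto
  then have real: "ereal (X_norm Linf g) = ?e" by (cases ?e) auto
  have "AE x in restrict_space lebesgue Q. ereal \<bar>g x\<bar> \<le> ?e" by (rule esssup_AE)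
  then have "AE x in restrict_space lebesgue Q. \<bar>g x\<bar> \<le> X_norm Linf g"
    unfolding real[symmetric] by simp
  then show "AE x in lborel. x \<in> Q \<longrightarrow> \<bar>g x\<bar> \<le> X_norm Linf g"
    by (simp add: AE_restrict_space_iff AE_completion_iff)
qed

lemma Linf_norm_le:
  assumes meas: "g \<in> borel_measurable lebesgue" and "periodic_2pi g" and B: "AE x in lborel. \<bar>g x\<bar> \<le> B"
  shows "g \<in> X_carrier Linf" "\<bar>X_norm Linf g\<bar> \<le> B"
proof -
  let ?e = "esssup (restrict_space lebesgue Q) (\<lambda>t. ereal \<bar>g t\<bar>)"
  have [measurable]: "g \<in> borel_measurable (restrict_space lebesgue Q)"
    using meas by (rule measurable_restrict_space1)
  have "AE x in restrict_space lebesgue Q. ereal \<bar>g x\<bar> \<le> ereal B"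
    using B by (auto simp: AE_restrict_space_iff AE_completion_iff elim: eventually_mono)
  then have le: "?e \<le> ereal B" by (intro esssup_I) auto
  moreover have nn: "0 \<le> ?e" by (rule esssup_abs_nonneg[OF meas])
  ultimately show "g \<in> X_carrier Linf" using assms by (auto simp: less_top[symmetric])
  show "\<bar>X_norm Linf g\<bar> \<le> B" using le nn by (cases ?e) auto
qed

lemma bdd_above_abs_continuous:
  fixes g :: "real \<Rightarrow> real"
  assumes "continuous_on UNIV g"
  shows "bdd_above ((\<lambda>x. \<bar>g x\<bar>) ` Q)"
  using assms by (intro bounded_imp_bdd_above compact_imp_bounded compact_continuous_image continuous_intros)
    (auto intro: continuous_on_subset)

lemma Cont_abs_le:
  assumes "g \<in> X_carrier Cont"
  shows "\<bar>g x\<bar> \<le> X_norm Cont g"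
proof -
  obtain j :: int where j: "x - 2 * pi * of_int j \<in> Q" using ex_shift_into_Q by blast
  have "g x = g (x - 2 * pi * of_int j)"
    using periodic_int[of g "x - 2 * pi * of_int j" j] assms by (simp add: periodic_2pi_def)
  then show ?thesis
    using cSUP_upper[OF j bdd_above_abs_continuous[of g]] assms by simp
qed

lemma Cont_norm_le:
  assumes "\<And>x. \<bar>g x\<bar> \<le> B"
  shows "\<bar>X_norm Cont g\<bar> \<le> B"
proof -
  have "X_norm Cont g \<le> B" using assms by (auto intro!: cSUP_least)
  moreover have "\<bar>g 0\<bar> \<le> X_norm Cont g"
    using cSUP_upper[of 0 Q "\<lambda>x. \<bar>g x\<bar>"] bdd_aboveI2[of Q "\<lambda>x. \<bar>g x\<bar>" B] assms by simp
  ultimately show ?thesis by simp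
qed

text \<open>Boundedness of these norms is what makes the supremum in the modulus of continuity a true
  supremum, since an unbounded set of reals would receive a default value.\<close>

lemma psi_carrier_bounded:
  assumes X: "admissible X" and f: "f \<in> X_carrier X" and [measurable]: "f \<in> borel_measurable borel"
  shows "\<exists>B. \<forall>t. (\<lambda>x. psi f x t) \<in> X_carrier X \<and> X_norm X (\<lambda>x. psi f x t) \<le> B"
proof -
  have per: "periodic_2pi f" using f by (cases X) auto
  then have per_psi: "periodic_2pi (\<lambda>x. psi f x t)" for t
    unfolding periodic_2pi_def[of "\<lambda>x. psi f x t"] by (simp add: psi_periodic)
  have meas: "(\<lambda>x. psi f x t) \<in> borel_measurable lebesgue" for t
    by (rule measurable_completion) simp
  show ?thesis
  proof (cases X)
    case (Lp p)
    then have p: "1 \<le> p" using X by simp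
    define K where "K = (\<integral>\<^sup>+x\<in>Q. ennreal (\<bar>f x\<bar> powr p) \<partial>lborel)"
    have K: "K < \<infinity>"
      using f per unfolding K_def Lp
      by (subst Lp_carrier_iff[symmetric]) (auto intro: measurable_completion)
    have le: "(\<integral>\<^sup>+x\<in>Q. ennreal (\<bar>psi f x t\<bar> powr p) \<partial>lborel) \<le> ennreal (2 powr p) * (K + K)" for t
    proof -
      have "(\<integral>\<^sup>+x\<in>Q. ennreal (\<bar>psi f x t\<bar> powr p) \<partial>lborel)
          \<le> (\<integral>\<^sup>+x. ennreal (2 powr p) * (ennreal (\<bar>f (x + t)\<bar> powr p) * indicator Q x
              + ennreal (\<bar>f (x + (- t))\<bar> powr p) * indicator Q x) \<partial>lborel)"
      proof (rule nn_integral_mono)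
        fix x
        let ?m = "max \<bar>f (x + t)\<bar> \<bar>f (x + (- t))\<bar>"
        have "\<bar>psi f x t\<bar> powr p \<le> (2 * ?m) powr p"
          using p by (intro powr_mono2) (auto simp: psi_def)
        also have "\<dots> = 2 powr p * ?m powr p" by (simp add: powr_mult)
        also have "\<dots> \<le> 2 powr p * (\<bar>f (x + t)\<bar> powr p + \<bar>f (x + (- t))\<bar> powr p)"
          by (intro mult_left_mono) (auto simp: max_def)
        finally have "ennreal (\<bar>psi f x t\<bar> powr p)
            \<le> ennreal (2 powr p) * (ennreal (\<bar>f (x + t)\<bar> powr p) + ennreal (\<bar>f (x + (- t))\<bar> powr p))"
          by (simp flip: ennreal_plus ennreal_mult)
        then show "ennreal (\<bar>psi f x t\<bar> powr p) * indicator Q x \<le> ennreal (2 powr p) *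
            (ennreal (\<bar>f (x + t)\<bar> powr p) * indicator Q x + ennreal (\<bar>f (x + (- t))\<bar> powr p) * indicator Q x)"
          by (auto simp: indicator_def)
      qed
      also have "\<dots> = ennreal (2 powr p) * ((\<integral>\<^sup>+x\<in>Q. ennreal (\<bar>f (x + t)\<bar> powr p) \<partial>lborel)
          + (\<integral>\<^sup>+x\<in>Q. ennreal (\<bar>f (x + (- t))\<bar> powr p) \<partial>lborel))"
        by (simp add: nn_integral_add nn_integral_cmult)
      also have "\<dots> = ennreal (2 powr p) * (K + K)"
        unfolding K_def using per
        by (intro arg_cong2[where f = "(*)"] arg_cong2[where f = "(+)"] refl
              nn_integral_periodic_translate[of "\<lambda>x. ennreal (\<bar>f x\<bar> powr p)"])
           (auto simp: periodic_2pi_def)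
      finally show ?thesis .
    qed
    obtain k where k: "K = ennreal k" "0 \<le> k" using K by (cases K) auto
    define B where "B = (2 powr p * (k + k)) powr (1 / p)"
    have B: "ennreal (B powr p) = ennreal (2 powr p) * (K + K)"
    proof -
      have "B powr p = 2 powr p * (k + k)"
        using p k(2) unfolding B_def powr_powr by simp
      also have "ennreal \<dots> = ennreal (2 powr p) * ennreal (k + k)"
        using k(2) by (intro ennreal_mult) auto
      also have "ennreal (k + k) = K + K"
        unfolding k(1) using k(2) by (intro ennreal_plus)
      finally show ?thesis .
    qed
    have car: "(\<lambda>x. psi f x t) \<in> X_carrier X" for t
      unfolding Lp Lp_carrier_iff[OF meas per_psi]
      by (rule le_less_trans[OF le]) (use K in \<open>simp add: ennreal_mult_less_top\<close>)
    moreover have "X_norm X (\<lambda>x. psi f x t) \<le> B" for t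
      unfolding Lp using le[of t] car[of t] p B by (intro Lp_norm_le) (auto simp: Lp B_def)
    ultimately show ?thesis by blast
  next
    case Linf
    define M where "M = X_norm Linf f"
    have ae: "AE x in lborel. \<bar>f x\<bar> \<le> M" using Linf_AE_le f by (simp add: Linf M_def)
    have "AE x in lborel. \<bar>psi f x t\<bar> \<le> 2 * M" for t
    proof -
      have "AE x in lborel. \<bar>f (t + 1 * x)\<bar> \<le> M" "AE x in lborel. \<bar>f (- t + 1 * x)\<bar> \<le> M"
        by (intro AE_borel_affine; use ae in simp)+
      then show ?thesis by eventually_elim (simp add: psi_def add.commute)
    qed
    then show ?thesis
      unfolding Linf using Linf_norm_le[OF meas per_psi] abs_le_D1 by blast
  next
    case Cont
    have cont: "continuous_on UNIV f" using f Cont by simp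
    have "\<bar>psi f x t\<bar> \<le> 2 * X_norm Cont f" for x t
      using Cont_abs_le[OF f[unfolded Cont], of "x + t"] Cont_abs_le[OF f[unfolded Cont], of "x - t"]
      unfolding psi_def by linarith
    from Cont_norm_le[OF this] have "\<bar>X_norm Cont (\<lambda>x. psi f x t)\<bar> \<le> 2 * X_norm Cont f" for t .
    moreover have "continuous_on UNIV (\<lambda>x. psi f x t)" for t
      unfolding psi_def
      by (intro continuous_on_diff continuous_on_compose2[OF cont] continuous_on_add continuous_on_id
          continuous_on_const) auto
    then have "(\<lambda>x. psi f x t) \<in> X_carrier Cont" for t
      using per_psi[of t] by simp
    ultimately show ?thesis
      unfolding Cont using abs_le_D1 by blast
  qed
qed

lemma psi_norm_le_modulus:
  assumes X: "admissible X" and f: "f \<in> X_carrier X" and [measurable]: "f \<in> borel_measurable borel"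
    and \<delta>: "0 < \<delta>"
  shows "X_norm X (\<lambda>x. psi f x \<delta>) \<le> conj_modulus2 X f \<delta>"
proof -
  obtain B where "\<And>t. X_norm X (\<lambda>x. psi f x t) \<le> B"
    using psi_carrier_bounded[OF assms(1-3)] by blast
  then have "bdd_above ((\<lambda>t. X_norm X (\<lambda>x. psi f x t)) ` {0<..\<delta>})" by (rule bdd_aboveI2)
  then show ?thesis
    unfolding conj_modulus2_def using \<delta> by (auto intro!: cSUP_upper)
qed

section \<open>Norms of kernel integrals\<close>

text \<open>The notion of \<open>almost every point\<close> that the norm of the space can detect: the supremum norm of
  continuous functions sees every point.\<close>

definition X_almost_everywhere :: "per_space \<Rightarrow> (real \<Rightarrow> bool) \<Rightarrow> bool" where
  "X_almost_everywhere X P \<longleftrightarrow> (if X = Cont then \<forall>x. P x else AE x in lborel. P x)"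

lemma X_almost_everywhere_mono:
  assumes "X_almost_everywhere X P" "\<And>x. P x \<Longrightarrow> R x"
  shows "X_almost_everywhere X R"
  using assms unfolding X_almost_everywhere_def by (metis (mono_tags, lifting) eventually_mono)

lemma X_almost_everywhere_AE: "X_almost_everywhere X P \<Longrightarrow> AE x in lborel. P x"
  unfolding X_almost_everywhere_def by (cases "X = Cont") simp_all

text \<open>Minkowski's inequality applied to \<open>\<bar>psi f x t * \<kappa> t\<bar>\<close> on the product of a period and \<open>(0, \<pi>]\<close>.\<close>

lemma kernel_transform_Lp:
  assumes p: "1 \<le> p" and f: "f \<in> X_carrier (Lp p)"
    and [measurable]: "f \<in> borel_measurable borel" "\<kappa> \<in> borel_measurable borel" "N \<in> borel_measurable borel"
    and N0: "\<And>t. 0 \<le> N t"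
    and N: "\<And>t. 0 < t \<Longrightarrow> t \<le> pi \<Longrightarrow> X_norm (Lp p) (\<lambda>x. psi f x t) \<le> N t"
    and W: "0 < W" "(\<integral>\<^sup>+t\<in>{0<..pi}. ennreal (N t * \<bar>\<kappa> t\<bar>) \<partial>lborel) \<le> ennreal W"
  defines "I \<equiv> \<lambda>x. \<integral>\<^sup>+t\<in>{0<..pi}. ennreal \<bar>psi f x t * \<kappa> t\<bar> \<partial>lborel"
  shows "AE x in lborel. I x < \<infinity>"
    and "(\<integral>\<^sup>+x\<in>Q. ennreal (enn2real (I x) powr p) \<partial>lborel) \<le> ennreal (W powr p)"
proof -
  have per: "periodic_2pi f" using f by simp
  define F where "F x t = \<bar>psi f x t * \<kappa> t\<bar> * indicator Q x * indicator {0<..pi} t" for x t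
  define N' where "N' t = N t * \<bar>\<kappa> t\<bar> * indicator {0<..pi} t" for t
  have slice: "(\<integral>\<^sup>+x. ennreal (F x t powr p) \<partial>lborel) \<le> ennreal (N' t powr p)" for t
  proof (cases "t \<in> {0<..pi}")
    case True
    have car: "(\<lambda>x. psi f x t) \<in> X_carrier (Lp p)"
      using psi_carrier_bounded[of "Lp p" f] p f by auto
    have "(\<integral>\<^sup>+x. ennreal (F x t powr p) \<partial>lborel)
        = (\<integral>\<^sup>+x. ennreal (\<bar>\<kappa> t\<bar> powr p) * (ennreal (\<bar>psi f x t\<bar> powr p) * indicator Q x) \<partial>lborel)"
      using True p unfolding F_def
      by (intro nn_integral_cong) (auto simp: indicator_def abs_mult powr_mult mult.commute simp flip: ennreal_mult)
    also have "\<dots> = ennreal (\<bar>\<kappa> t\<bar> powr p) * ennreal (X_norm (Lp p) (\<lambda>x. psi f x t) powr p)"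
      unfolding Lp_norm_powr[OF car p] by (rule nn_integral_cmult) measurable
    also have "\<dots> \<le> ennreal (\<bar>\<kappa> t\<bar> powr p) * ennreal (N t powr p)"
      using N[of t] True p by (intro mult_left_mono ennreal_leI powr_mono2) auto
    also have "\<dots> = ennreal (N' t powr p)"
      using True N0 by (simp add: N'_def powr_mult mult.commute flip: ennreal_mult)
    finally show ?thesis .
  qed (use p in \<open>simp add: F_def N'_def\<close>)
  have "(\<integral>\<^sup>+t. ennreal (N' t) \<partial>lborel) = (\<integral>\<^sup>+t\<in>{0<..pi}. ennreal (N t * \<bar>\<kappa> t\<bar>) \<partial>lborel)"
    unfolding N'_def by (intro nn_integral_cong) (auto simp: indicator_def)
  with W have total: "(\<integral>\<^sup>+t. ennreal (N' t) \<partial>lborel) \<le> ennreal W" by simp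
  have F_meas: "case_prod F \<in> borel_measurable (lborel \<Otimes>\<^sub>M lborel)"
    unfolding F_def by measurable
  have N'_meas: "N' \<in> borel_measurable lborel"
    unfolding N'_def by measurable
  have F0: "0 \<le> F x t" for x t by (simp add: F_def)
  have N'0: "0 \<le> N' t" for t using N0 by (simp add: N'_def)
  note Mink = lborel_pair.Minkowski_integral_inequality[OF F_meas N'_meas F0 N'0 p W(1) slice total]
  have F_I: "(\<integral>\<^sup>+t. ennreal (F x t) \<partial>lborel) = (if x \<in> Q then I x else 0)" for x
    unfolding F_def I_def by (auto intro!: nn_integral_cong simp: indicator_def)
  show "AE x in lborel. I x < \<infinity>"
  proof (rule periodic_AE)
    show "(I (x + 2 * pi) < \<infinity>) = (I x < \<infinity>)" for x
      unfolding I_def by (simp add: psi_periodic[OF per])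
    show "AE x in lborel. x \<in> Q \<longrightarrow> I x < \<infinity>"
      using Mink(1) unfolding F_I by eventually_elim auto
  qed
  have "(\<integral>\<^sup>+x\<in>Q. ennreal (enn2real (I x) powr p) \<partial>lborel)
      = (\<integral>\<^sup>+x. ennreal (enn2real (\<integral>\<^sup>+t. ennreal (F x t) \<partial>lborel) powr p) \<partial>lborel)"
    unfolding F_I by (intro nn_integral_cong) (use p in \<open>auto simp: indicator_def\<close>)
  also have "\<dots> \<le> ennreal (W powr p)" by (rule Mink(2))
  finally show "(\<integral>\<^sup>+x\<in>Q. ennreal (enn2real (I x) powr p) \<partial>lborel) \<le> ennreal (W powr p)" .
qed

text \<open>For the two supremum norms the bound \<open>\<bar>psi f x t\<bar> \<le> N t\<close> holds pointwise; in the essential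
  case only for almost every \<open>x\<close> at each \<open>t\<close>, and Tonelli's theorem exchanges the two quantifiers.\<close>

lemma kernel_transform_pointwise:
  assumes X: "admissible X" "\<And>p. X \<noteq> Lp p" and f: "f \<in> X_carrier X"
    and [measurable]: "f \<in> borel_measurable borel" "\<kappa> \<in> borel_measurable borel" "N \<in> borel_measurable borel"
    and N: "\<And>t. 0 < t \<Longrightarrow> t \<le> pi \<Longrightarrow> X_norm X (\<lambda>x. psi f x t) \<le> N t"
    and W: "(\<integral>\<^sup>+t\<in>{0<..pi}. ennreal (N t * \<bar>\<kappa> t\<bar>) \<partial>lborel) \<le> ennreal W"
  shows "X_almost_everywhere X (\<lambda>x. (\<integral>\<^sup>+t\<in>{0<..pi}. ennreal \<bar>psi f x t * \<kappa> t\<bar> \<partial>lborel) \<le> ennreal W)"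
proof -
  have le: "(\<integral>\<^sup>+t\<in>{0<..pi}. ennreal \<bar>psi f x t * \<kappa> t\<bar> \<partial>lborel) \<le> ennreal W"
    if "AE t in lborel. t \<in> {0<..pi} \<longrightarrow> \<bar>psi f x t\<bar> \<le> N t" for x
  proof -
    have "(\<integral>\<^sup>+t\<in>{0<..pi}. ennreal \<bar>psi f x t * \<kappa> t\<bar> \<partial>lborel)
        \<le> (\<integral>\<^sup>+t\<in>{0<..pi}. ennreal (N t * \<bar>\<kappa> t\<bar>) \<partial>lborel)"
      by (rule nn_integral_mono_AE, use that in eventually_elim)
         (auto simp: indicator_def abs_mult intro!: ennreal_leI mult_right_mono)
    then show ?thesis using W by simp
  qed
  have car: "(\<lambda>x. psi f x t) \<in> X_carrier X" for t
    using psi_carrier_bounded[OF X(1) f] by auto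
  show ?thesis
  proof (cases "X = Cont")
    case True
    have "\<bar>psi f x t\<bar> \<le> N t" if "t \<in> {0<..pi}" for x t
      using Cont_abs_le[of "\<lambda>x. psi f x t" x] car[of t] N[of t] that unfolding True by force
    then show ?thesis using True le by (auto simp: X_almost_everywhere_def)
  next
    case False
    then have Linf: "X = Linf" using X by (cases X) auto
    have "AE x in lborel. t \<in> {0<..pi} \<longrightarrow> \<bar>psi f x t\<bar> \<le> N t" for t
    proof (cases "t \<in> {0<..pi}")
      case True
      from Linf_AE_le[OF car[of t, unfolded Linf]] show ?thesis
        using N[of t] True unfolding Linf by (auto elim: eventually_mono)
    next
      case False
      then show ?thesis by (intro AE_I2) auto
    qed
    then have "AE t in lborel. AE x in lborel. t \<in> {0<..pi} \<longrightarrow> \<bar>psi f x t\<bar> \<le> N t"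
      by simp
    then have "AE x in lborel. AE t in lborel. t \<in> {0<..pi} \<longrightarrow> \<bar>psi f x t\<bar> \<le> N t"
      by (subst lborel_pair.AE_commute) measurable
    then have "AE x in lborel. (\<integral>\<^sup>+t\<in>{0<..pi}. ennreal \<bar>psi f x t * \<kappa> t\<bar> \<partial>lborel) \<le> ennreal W"
      by (rule eventually_mono) (rule le)
    then show ?thesis using False by (simp add: X_almost_everywhere_def)
  qed
qed

lemma kernel_transform_finite:
  assumes X: "admissible X" and f: "f \<in> X_carrier X"
    and [measurable]: "f \<in> borel_measurable borel" "\<kappa> \<in> borel_measurable borel" "N \<in> borel_measurable borel"
    and N0: "\<And>t. 0 \<le> N t"
    and N: "\<And>t. 0 < t \<Longrightarrow> t \<le> pi \<Longrightarrow> X_norm X (\<lambda>x. psi f x t) \<le> N t"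
    and W: "(\<integral>\<^sup>+t\<in>{0<..pi}. ennreal (N t * \<bar>\<kappa> t\<bar>) \<partial>lborel) < \<infinity>"
  shows "X_almost_everywhere X (\<lambda>x. set_integrable lborel {0<..pi} (\<lambda>t. psi f x t * \<kappa> t))"
proof -
  let ?I = "\<lambda>x. \<integral>\<^sup>+t\<in>{0<..pi}. ennreal \<bar>psi f x t * \<kappa> t\<bar> \<partial>lborel"
  obtain w where w: "(\<integral>\<^sup>+t\<in>{0<..pi}. ennreal (N t * \<bar>\<kappa> t\<bar>) \<partial>lborel) = ennreal w" "0 \<le> w"
    using W by (cases "\<integral>\<^sup>+t\<in>{0<..pi}. ennreal (N t * \<bar>\<kappa> t\<bar>) \<partial>lborel") auto
  have "X_almost_everywhere X (\<lambda>x. ?I x < \<infinity>)"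
  proof (cases "\<exists>p. X = Lp p")
    case True
    then obtain p where p: "X = Lp p" by blast
    have "AE x in lborel. ?I x < \<infinity>"
      by (rule kernel_transform_Lp(1)[of p f \<kappa> N "w + 1"]) (use X f N0 N w in \<open>auto simp: p\<close>)
    then show ?thesis by (simp add: X_almost_everywhere_def p)
  next
    case False
    then have "X_almost_everywhere X (\<lambda>x. ?I x \<le> ennreal w)"
      using w X f N by (intro kernel_transform_pointwise[where N = N]) auto
    then show ?thesis
      by (rule X_almost_everywhere_mono) (auto intro: le_less_trans)
  qed
  moreover have "set_integrable lborel {0<..pi} (\<lambda>t. psi f x t * \<kappa> t) \<longleftrightarrow> ?I x < \<infinity>" for x
    by (rule set_integrable_iff_nn_integral_finite) measurable
  ultimately show ?thesis by simp
qed

text \<open>All three norms obey the same principle: an integral of \<open>psi f x t\<close> against a kernel \<open>\<kappa>\<close> has norm at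
  most the integral of \<open>\<bar>\<kappa>\<bar>\<close> weighted by the norms of the slices. The function \<open>\<Phi>\<close> is only required to
  agree with the integral where the norm can tell, as the conjugate function is defined through
  a limit that may fail on a null set.\<close>

lemma kernel_transform_norm_le:
  assumes X: "admissible X" and f: "f \<in> X_carrier X"
    and [measurable]: "f \<in> borel_measurable borel" "\<kappa> \<in> borel_measurable borel" "N \<in> borel_measurable borel"
    and N0: "\<And>t. 0 \<le> N t"
    and N: "\<And>t. 0 < t \<Longrightarrow> t \<le> pi \<Longrightarrow> X_norm X (\<lambda>x. psi f x t) \<le> N t"
    and W: "0 \<le> W" "(\<integral>\<^sup>+t\<in>{0<..pi}. ennreal (N t * \<bar>\<kappa> t\<bar>) \<partial>lborel) \<le> ennreal W"
    and per: "periodic_2pi \<Phi>"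
    and \<Phi>: "X_almost_everywhere X (\<lambda>x. \<Phi> x = (LINT t:{0<..pi}|lborel. psi f x t * \<kappa> t))"
  shows "\<Phi> \<in> X_carrier X" "\<bar>X_norm X \<Phi>\<bar> \<le> W"
proof -
  define \<Psi> where "\<Psi> x = (LINT t:{0<..pi}|lborel. psi f x t * \<kappa> t)" for x
  define I where "I x = (\<integral>\<^sup>+t\<in>{0<..pi}. ennreal \<bar>psi f x t * \<kappa> t\<bar> \<partial>lborel)" for x
  have [measurable]: "\<Psi> \<in> borel_measurable borel" "I \<in> borel_measurable borel"
    unfolding \<Psi>_def I_def set_lebesgue_integral_def by measurable
  have \<Psi>_le: "\<bar>\<Psi> x\<bar> \<le> enn2real (I x)" if "I x < \<infinity>" for x
    using that unfolding \<Psi>_def I_def by (intro set_integral_abs_le_nn) measurable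
  have \<Phi>\<Psi>: "AE x in lborel. \<Phi> x = \<Psi> x" using X_almost_everywhere_AE[OF \<Phi>] by (simp only: \<Psi>_def)
  have \<Phi>_meas: "\<Phi> \<in> borel_measurable lebesgue"
  proof (rule borel_measurable_AE)
    show "\<Psi> \<in> borel_measurable lebesgue" by (rule measurable_completion) simp
    show "AE x in lebesgue. \<Psi> x = \<Phi> x"
      unfolding AE_completion_iff using \<Phi>\<Psi> by eventually_elim simp
  qed
  have "\<Phi> \<in> X_carrier X \<and> \<bar>X_norm X \<Phi>\<bar> \<le> W"
  proof (cases "\<exists>p. X = Lp p")
    case True
    then obtain p where Xp: "X = Lp p" by blast
    then have p: "1 \<le> p" using X by simp
    \<comment> \<open>Minkowski's inequality above needs a positive bound, so the case \<open>W = 0\<close> is reached from \<open>w > W\<close>.\<close>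
    have le: "(\<integral>\<^sup>+x\<in>Q. ennreal (\<bar>\<Phi> x\<bar> powr p) \<partial>lborel) \<le> ennreal (w powr p)" if w: "W < w" for w
    proof -
      have w': "0 < w" "(\<integral>\<^sup>+t\<in>{0<..pi}. ennreal (N t * \<bar>\<kappa> t\<bar>) \<partial>lborel) \<le> ennreal w"
        using w W(1) order_trans[OF W(2) ennreal_leI[of W w]] by simp_all
      note Lp = kernel_transform_Lp[of p f \<kappa> N w, folded I_def, OF p f[unfolded Xp] _ _ _ N0 N[unfolded Xp] w']
      have "AE x in lborel. I x < \<infinity>" by (rule Lp(1)) auto
      with \<Phi>\<Psi> have ae: "AE x in lborel. \<bar>\<Phi> x\<bar> \<le> enn2real (I x)"
        by eventually_elim (simp add: \<Psi>_le)
      have "(\<integral>\<^sup>+x\<in>Q. ennreal (\<bar>\<Phi> x\<bar> powr p) \<partial>lborel)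
          \<le> (\<integral>\<^sup>+x\<in>Q. ennreal (enn2real (I x) powr p) \<partial>lborel)"
        by (rule nn_integral_mono_AE, use ae in eventually_elim)
           (use p in \<open>intro mult_right_mono ennreal_leI powr_mono2, simp_all\<close>)
      also have "\<dots> \<le> ennreal (w powr p)" by (rule Lp(2)) auto
      finally show ?thesis .
    qed
    have car: "\<Phi> \<in> X_carrier (Lp p)"
      unfolding Lp_carrier_iff[OF \<Phi>_meas per] by (rule le_less_trans[OF le[of "W + 1"]]) simp_all
    have "X_norm (Lp p) \<Phi> \<le> w" if "W < w" for w
      by (rule Lp_norm_le[OF car p _ le[OF that]]) (use W(1) that in simp)
    then have "X_norm (Lp p) \<Phi> \<le> W" by (rule dense_ge)
    moreover have "0 \<le> X_norm (Lp p) \<Phi>" by simp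
    ultimately show ?thesis using car by (simp add: Xp)
  next
    case False
    then have "X_almost_everywhere X (\<lambda>x. I x \<le> ennreal W)"
      unfolding I_def by (intro kernel_transform_pointwise[where N = N] X f N W) simp_all
    then have bound: "X_almost_everywhere X (\<lambda>x. \<bar>\<Psi> x\<bar> \<le> W)"
    proof -
      have "\<bar>\<Psi> x\<bar> \<le> W" if I: "I x \<le> ennreal W" for x
      proof -
        have "I x < \<infinity>" using I by (rule le_less_trans) simp
        from \<Psi>_le[OF this] enn2real_leI[OF W(1) I] show ?thesis by simp
      qed
      then show ?thesis by (rule X_almost_everywhere_mono[OF \<open>X_almost_everywhere X (\<lambda>x. I x \<le> ennreal W)\<close>])
    qed
    show ?thesis
    proof (cases "X = Cont")
      case True
      have \<Phi>_eq: "\<Phi> = \<Psi>" using \<Phi> by (simp add: True X_almost_everywhere_def \<Psi>_def fun_eq_iff)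
      have f_cont: "continuous_on UNIV f" using f True by simp
      have car: "(\<lambda>x. psi f x t) \<in> X_carrier Cont" for t
        using psi_carrier_bounded[OF X f assms(3)] unfolding True by blast
      \<comment> \<open>Continuity of the integral follows by domination, with the dominating function \<open>N \<bar>\<kappa>\<bar>\<close>.\<close>
      have w_int: "integrable lborel (\<lambda>t. indicator {0<..pi} t *\<^sub>R (N t * \<bar>\<kappa> t\<bar>))"
      proof -
        have "set_integrable lborel {0<..pi} (\<lambda>t. N t * \<bar>\<kappa> t\<bar>)"
          using le_less_trans[OF W(2) ennreal_less_top]
          by (subst set_integrable_iff_nn_integral_finite) (simp_all add: N0 abs_mult)
        then show ?thesis by (simp add: set_integrable_def)
      qed
      have "\<Psi> \<midarrow>x\<rightarrow> \<Psi> x" for x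
        unfolding tendsto_at_iff_sequentially comp_def
      proof (intro allI impI)
        fix s :: "nat \<Rightarrow> real" assume s: "s \<longlonglongrightarrow> x"
        show "(\<lambda>i. \<Psi> (s i)) \<longlonglongrightarrow> \<Psi> x"
          unfolding \<Psi>_def set_lebesgue_integral_def
        proof (rule integral_dominated_convergence[OF _ _ w_int])
          have "(\<lambda>i. psi f (s i) t) \<longlonglongrightarrow> psi f x t" for t
            unfolding psi_def using s
            by (intro tendsto_intros continuous_on_tendsto_compose[OF f_cont]) auto
          then show "AE t in lborel. (\<lambda>i. indicat_real {0<..pi} t *\<^sub>R (psi f (s i) t * \<kappa> t))
              \<longlonglongrightarrow> indicat_real {0<..pi} t *\<^sub>R (psi f x t * \<kappa> t)"
            by (auto intro!: tendsto_intros)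
          have "\<bar>psi f y t\<bar> \<le> N t" if "t \<in> {0<..pi}" for y t
            using Cont_abs_le[OF car[of t], of y] N[of t] that unfolding True by force
          then show "AE t in lborel. norm (indicat_real {0<..pi} t *\<^sub>R (psi f (s i) t * \<kappa> t))
              \<le> indicat_real {0<..pi} t *\<^sub>R (N t * \<bar>\<kappa> t\<bar>)" for i
            by (auto simp: indicator_def abs_mult intro!: mult_right_mono)
        qed measurable
      qed
      then have "continuous_on UNIV \<Psi>"
        by (simp add: continuous_on_def)
      moreover have "\<bar>X_norm Cont \<Psi>\<bar> \<le> W"
        using bound True by (intro Cont_norm_le) (simp add: X_almost_everywhere_def)
      ultimately show ?thesis using per by (simp add: True \<Phi>_eq)
    next
      case nCont: False
      then have Linf: "X = Linf" using False by (cases X) auto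
      have "AE x in lborel. \<bar>\<Phi> x\<bar> \<le> W"
        using X_almost_everywhere_AE[OF bound] \<Phi>\<Psi> by eventually_elim simp
      from Linf_norm_le[OF \<Phi>_meas per this] show ?thesis by (simp add: Linf)
    qed
  qed
  then show "\<Phi> \<in> X_carrier X" "\<bar>X_norm X \<Phi>\<bar> \<le> W" by auto
qed

section \<open>Deviations as kernel integrals\<close>

lemma set_integrable_mult_bounded:
  fixes g b :: "real \<Rightarrow> real"
  assumes g: "set_integrable lborel A g" and [measurable]: "b \<in> borel_measurable borel" "A \<in> sets borel"
    and B: "\<And>t. t \<in> A \<Longrightarrow> \<bar>b t\<bar> \<le> B"
  shows "set_integrable lborel A (\<lambda>t. g t * b t)"
proof -
  have "integrable lborel (\<lambda>t. B * (indicator A t *\<^sub>R g t))"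
    using g unfolding set_integrable_def by (rule integrable_mult_right)
  then have "integrable lborel (\<lambda>t. (indicator A t *\<^sub>R g t) * b t)"
  proof (rule Bochner_Integration.integrable_bound)
    show "(\<lambda>t. (indicator A t *\<^sub>R g t) * b t) \<in> borel_measurable lborel"
      using g unfolding set_integrable_def by measurable
    show "AE t in lborel. norm ((indicator A t *\<^sub>R g t) * b t) \<le> norm (B * (indicator A t *\<^sub>R g t))"
    proof (rule AE_I2)
      fix t
      show "norm ((indicator A t *\<^sub>R g t) * b t) \<le> norm (B * (indicator A t *\<^sub>R g t))"
        using mult_right_mono[OF order_trans[OF B[of t] abs_ge_self], of "\<bar>g t\<bar>"]
        by (auto simp: indicator_def abs_mult mult.commute)
    qed
  qed
  then show ?thesis by (simp add: set_integrable_def mult.assoc)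
qed

lemma set_integral_fold:
  fixes h :: "real \<Rightarrow> real"
  assumes h: "set_integrable lborel Q h"
  shows "set_integrable lborel {0<..pi} (\<lambda>u. h u + h (- u))"
    and "(LINT u:Q|lborel. h u) = (LINT u:{0<..pi}|lborel. h u + h (- u))"
proof -
  have pos: "set_integrable lborel {0<..pi} h" and neg: "set_integrable lborel {-pi..<0} h"
    by (rule set_integrable_subset[OF h]; auto)+
  have ind: "indicator {-pi..<0} (- u) = (indicator {0<..pi} u :: real)" for u :: real
    by (auto simp: indicator_def)
  have neg': "set_integrable lborel {0<..pi} (\<lambda>u. h (- u))"
    using lborel_integrable_real_affine[OF neg[unfolded set_integrable_def], of "-1" 0]
    by (simp add: set_integrable_def ind)
  have neg_eq: "(LINT u:{-pi..<0}|lborel. h u) = (LINT u:{0<..pi}|lborel. h (- u))"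
    using lborel_integral_real_affine[of "-1" "\<lambda>u. indicator {-pi..<0} u *\<^sub>R h u" 0]
    by (simp add: set_lebesgue_integral_def ind)
  show "set_integrable lborel {0<..pi} (\<lambda>u. h u + h (- u))"
    using pos neg' by (rule set_integral_add)
  have "(LINT u:Q|lborel. h u) = (LINT u:{0<..pi} \<union> {-pi..<0}|lborel. h u)"
    unfolding set_lebesgue_integral_def
  proof (rule integral_cong_AE)
    have "AE u in lborel. u \<noteq> (0::real)" by (rule AE_lborel_singleton)
    then show "AE u in lborel. indicat_real Q u *\<^sub>R h u = indicat_real ({0<..pi} \<union> {- pi..<0}) u *\<^sub>R h u"
      by eventually_elim (auto simp: indicator_def)
    show "(\<lambda>u. indicat_real Q u *\<^sub>R h u) \<in> borel_measurable lborel"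
      using h by (simp add: set_integrable_def)
    have "set_integrable lborel ({0<..pi} \<union> {- pi..<0}) h"
      using pos neg by (rule set_integrable_Un) auto
    then show "(\<lambda>u. indicat_real ({0<..pi} \<union> {- pi..<0}) u *\<^sub>R h u) \<in> borel_measurable lborel"
      by (simp add: set_integrable_def)
  qed
  also have "\<dots> = (LINT u:{0<..pi}|lborel. h u) + (LINT u:{-pi..<0}|lborel. h u)"
    using pos neg by (intro set_integral_Un) auto
  also have "\<dots> = (LINT u:{0<..pi}|lborel. h u + h (- u))"
    unfolding neg_eq using pos neg' by (simp add: set_integral_add)
  finally show "(LINT u:Q|lborel. h u) = (LINT u:{0<..pi}|lborel. h u + h (- u))" .
qed

lemma sin_half_ge:
  fixes t :: real
  assumes "0 < t" "t \<le> pi"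
  shows "t / pi \<le> sin (t / 2)"
  using sin_ge_linear[of "t / 2"] assms by simp

lemma sin_half_pos:
  fixes t :: real
  assumes "0 < t" "t \<le> pi"
  shows "0 < sin (t / 2)"
  using sin_half_ge[OF assms] assms by (smt (verit) divide_pos_pos pi_gt_zero)

lemma half_inverse_sin_le:
  fixes t :: real
  assumes "0 < t" "t \<le> pi"
  shows "1 / (2 * sin (t / 2)) \<le> pi / (2 * t)"
  using sin_half_ge[OF assms] sin_half_pos[OF assms] assms by (simp add: field_simps)

lemma conj_Dirichlet_kernel:
  fixes t :: real
  assumes "0 < t" "t \<le> pi"
  shows "(\<Sum>\<nu>=1..k. sin (real \<nu> * t))
    = 1 / 2 * cot (t / 2) - cos ((real k + 1 / 2) * t) / (2 * sin (t / 2))"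
proof -
  have s: "0 < sin (t / 2)" by (rule sin_half_pos[OF assms])
  have "2 * sin (t / 2) * (\<Sum>\<nu>=1..k. sin (real \<nu> * t)) = cos (t / 2) - cos ((real k + 1 / 2) * t)"
  proof (induction k)
    case (Suc k)
    have "cos ((real k + 1 / 2) * t) = cos (real (Suc k) * t - t / 2)"
      "cos ((real (Suc k) + 1 / 2) * t) = cos (real (Suc k) * t + t / 2)"
      by (simp_all add: algebra_simps)
    then have "2 * sin (t / 2) * sin (real (Suc k) * t)
        = cos ((real k + 1 / 2) * t) - cos ((real (Suc k) + 1 / 2) * t)"
      by (simp only: cos_add cos_diff) simp
    with Suc.IH show ?case by (simp add: distrib_left)
  qed simp
  then show ?thesis using s by (simp add: cot_def field_simps)
qed

text \<open>The kernel of the deviation from the conjugate function truncated at \<open>\<epsilon>\<close>; the value \<open>\<epsilon> = 0\<close> belongs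
  to the conjugate function itself. Treating the truncation as part of the kernel avoids a separate
  triangle inequality in each of the norms.\<close>

definition residual_kernel :: "(nat \<Rightarrow> real) \<Rightarrow> real \<Rightarrow> real \<Rightarrow> real" where
  "residual_kernel c \<epsilon> t =
    1 / pi * (mean_kernel c t / (2 * sin (t / 2)) - (if t < \<epsilon> then 1 / 2 * cot (t / 2) else 0))"

lemma residual_kernel_measurable [measurable]: "residual_kernel c \<epsilon> \<in> borel_measurable borel"
  unfolding residual_kernel_def cot_def by measurable

lemma residual_kernel_le:
  assumes "0 < t" "t \<le> pi"
  shows "\<bar>residual_kernel c \<epsilon> t\<bar> \<le> 1 / (2 * t) * (\<bar>mean_kernel c t\<bar> + (if t < \<epsilon> then 1 else 0))"
proof -
  have s: "0 < sin (t / 2)" by (rule sin_half_pos[OF assms])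
  have "residual_kernel c \<epsilon> t
      = 1 / pi * (1 / (2 * sin (t / 2)) * (mean_kernel c t - (if t < \<epsilon> then cos (t / 2) else 0)))"
    by (simp add: residual_kernel_def cot_def diff_divide_distrib)
  also have "\<bar>\<dots>\<bar> = 1 / pi * (1 / (2 * sin (t / 2)) * \<bar>mean_kernel c t - (if t < \<epsilon> then cos (t / 2) else 0)\<bar>)"
    using s by (simp add: abs_mult)
  also have "\<dots> \<le> 1 / pi * (pi / (2 * t) * (\<bar>mean_kernel c t\<bar> + (if t < \<epsilon> then 1 else 0)))"
  proof (intro mult_left_mono mult_mono half_inverse_sin_le assms)
    show "\<bar>mean_kernel c t - (if t < \<epsilon> then cos (t / 2) else 0)\<bar> \<le> \<bar>mean_kernel c t\<bar> + (if t < \<epsilon> then 1 else 0)"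
      using abs_triangle_ineq4[of "mean_kernel c t" "cos (t / 2)"] abs_cos_le_one[of "t / 2"]
      by (cases "t < \<epsilon>"; simp only: if_True if_False; linarith)
  qed (use assms in auto)
  finally show ?thesis by simp
qed

locale periodic_integrable =
  fixes f :: "real \<Rightarrow> real"
  assumes f_meas [measurable]: "f \<in> borel_measurable borel"
    and f_per: "periodic_2pi f"
    and f_int: "set_integrable lborel Q f"
begin

lemma f_shift: "f (x + 2 * pi) = f x"
  using f_per by (simp add: periodic_2pi_def)

lemma psi_integrable: "set_integrable lborel {0<..pi} (psi f x)"
proof -
  have f_refl: "set_integrable lborel Q (\<lambda>u. f (x - u))"
    by (rule set_integral_periodic_reflect(1)[OF f_meas f_shift f_int])
  have ind: "indicator Q (- u) = (indicator Q u :: real)" for u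
    by (auto simp: indicator_def)
  have "set_integrable lborel Q (\<lambda>u. f (x + u))"
    using lborel_integrable_real_affine[OF f_refl[unfolded set_integrable_def], of "-1" 0]
    by (simp add: set_integrable_def ind)
  then have "set_integrable lborel Q (\<lambda>u. f (x + u) - f (x - u))"
    using f_refl by (rule set_integral_diff)
  then show ?thesis unfolding psi_def by (rule set_integrable_subset) auto
qed

text \<open>The substitution \<open>u = x - t\<close> turns the harmonic into the integral of \<open>f (x - u) sin (\<nu> u)\<close> over a period,
  and oddness of the sine folds it onto \<open>(0, \<pi>]\<close>.\<close>

lemma conj_harmonic_eq:
  "fourier_a f \<nu> * sin (real \<nu> * x) - fourier_b f \<nu> * cos (real \<nu> * x)
    = - (1 / pi) * (LINT t:{0<..pi}|lborel. psi f x t * sin (real \<nu> * t))"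
proof -
  let ?g = "\<lambda>t. f t * sin (real \<nu> * (x - t))"
  have g_meas: "?g \<in> borel_measurable borel" by measurable
  have g_per: "?g (t + 2 * pi) = ?g t" for t
  proof -
    have "real \<nu> * (x - (t + 2 * pi)) = real \<nu> * (x - t) - 2 * real \<nu> * pi"
      by (simp add: algebra_simps)
    then have "sin (real \<nu> * (x - (t + 2 * pi))) = sin (real \<nu> * (x - t))"
      by (simp only: sin_diff) simp
    then show ?thesis by (simp add: f_shift)
  qed
  have Q_borel: "Q \<in> sets borel" by simp
  have ic: "set_integrable lborel Q (\<lambda>t. f t * cos (real \<nu> * t))"
    and isin: "set_integrable lborel Q (\<lambda>t. f t * sin (real \<nu> * t))"
    and ig: "set_integrable lborel Q ?g"
    by (rule set_integrable_mult_bounded[OF f_int, of _ 1]; simp)+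
  have "fourier_a f \<nu> * sin (real \<nu> * x) - fourier_b f \<nu> * cos (real \<nu> * x)
      = 1 / pi * ((LINT t:Q|lborel. sin (real \<nu> * x) * (f t * cos (real \<nu> * t)))
        - (LINT t:Q|lborel. cos (real \<nu> * x) * (f t * sin (real \<nu> * t))))"
    unfolding fourier_a_def fourier_b_def set_integral_mult_right
      lebesgue_set_integral_eq_lborel[OF ic Q_borel] lebesgue_set_integral_eq_lborel[OF isin Q_borel]
    by (simp only: right_diff_distrib mult_ac)
  also have "(LINT t:Q|lborel. sin (real \<nu> * x) * (f t * cos (real \<nu> * t)))
        - (LINT t:Q|lborel. cos (real \<nu> * x) * (f t * sin (real \<nu> * t)))
      = (LINT t:Q|lborel. sin (real \<nu> * x) * (f t * cos (real \<nu> * t)) - cos (real \<nu> * x) * (f t * sin (real \<nu> * t)))"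
    using ic isin by (intro set_integral_diff(2)[symmetric] set_integrable_mult_right) auto
  also have "\<dots> = (LINT t:Q|lborel. ?g t)"
    by (rule set_lebesgue_integral_cong) (auto simp: right_diff_distrib sin_diff algebra_simps)
  also have "\<dots> = (LINT u:Q|lborel. ?g (x - u))"
    by (rule set_integral_periodic_reflect(2)[symmetric, OF g_meas g_per ig])
  also have "\<dots> = (LINT u:{0<..pi}|lborel. ?g (x - u) + ?g (x - - u))"
    by (rule set_integral_fold(2)[OF set_integral_periodic_reflect(1)[OF g_meas g_per ig]])
  also have "\<dots> = (LINT u:{0<..pi}|lborel. - (psi f x u * sin (real \<nu> * u)))"
    by (rule set_lebesgue_integral_cong) (auto simp: psi_def algebra_simps)
  also have "\<dots> = - (LINT u:{0<..pi}|lborel. psi f x u * sin (real \<nu> * u))"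
    by (rule set_integral_uminus) (rule set_integrable_mult_bounded[OF psi_integrable, of _ 1]; simp)
  finally show ?thesis by simp
qed

lemma conj_partial_sum_eq:
  "conj_partial_sum f k x
    = - (1 / pi) * (LINT t:{0<..pi}|lborel. psi f x t * (\<Sum>\<nu>=1..k. sin (real \<nu> * t)))"
proof -
  have int: "integrable lborel (\<lambda>t. indicator {0<..pi} t *\<^sub>R (psi f x t * sin (real \<nu> * t)))" for \<nu>
    using set_integrable_mult_bounded[OF psi_integrable, of "\<lambda>t. sin (real \<nu> * t)" 1]
    by (simp add: set_integrable_def)
  have "conj_partial_sum f k x = - (1 / pi) * (\<Sum>\<nu>=1..k. LINT t:{0<..pi}|lborel. psi f x t * sin (real \<nu> * t))"
    unfolding conj_partial_sum_def conj_harmonic_eq by (simp add: sum_distrib_left)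
  also have "(\<Sum>\<nu>=1..k. LINT t:{0<..pi}|lborel. psi f x t * sin (real \<nu> * t))
      = (LINT t:{0<..pi}|lborel. psi f x t * (\<Sum>\<nu>=1..k. sin (real \<nu> * t)))"
    unfolding set_lebesgue_integral_def using int
    by (subst Bochner_Integration.integral_sum[symmetric]) (auto simp: sum_distrib_left)
  finally show ?thesis .
qed

text \<open>At a point \<open>x\<close> where \<open>psi f x t / t\<close> is integrable, the conjugate function is an absolutely convergent
  integral and the matrix means may be summed under the integral sign.\<close>

context
  fixes x :: real
  assumes dini: "set_integrable lborel {0<..pi} (\<lambda>t. psi f x t * (1 / t))"
begin

lemma psi_kernel_integrable:
  assumes [measurable]: "b \<in> borel_measurable borel"
    and b: "\<And>t. 0 < t \<Longrightarrow> t \<le> pi \<Longrightarrow> \<bar>b t\<bar> \<le> 1"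
  shows "set_integrable lborel {0<..pi} (\<lambda>t. psi f x t * (b t / (2 * sin (t / 2))))"
proof -
  have "set_integrable lborel {0<..pi} (\<lambda>t. (psi f x t * (1 / t)) * (t * (1 / (2 * sin (t / 2))) * b t))"
  proof (rule set_integrable_mult_bounded[OF dini])
    fix t assume "t \<in> {0<..pi}"
    then have t: "0 < t" "t \<le> pi" by auto
    have "\<bar>t * (1 / (2 * sin (t / 2))) * b t\<bar> = t * (1 / (2 * sin (t / 2))) * \<bar>b t\<bar>"
      using t sin_half_pos[OF t] by (simp add: abs_mult)
    also have "\<dots> \<le> t * (pi / (2 * t)) * 1"
      using t sin_half_pos[OF t] by (intro mult_mono half_inverse_sin_le b) auto
    finally show "\<bar>t * (1 / (2 * sin (t / 2))) * b t\<bar> \<le> pi / 2" using t by simp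
  qed measurable
  then show ?thesis
    by (rule iffD1[OF set_integrable_cong, rotated -1]) auto
qed

lemma psi_cot_integrable: "set_integrable lborel {0<..pi} (\<lambda>t. psi f x t * (1 / 2 * cot (t / 2)))"
  using psi_kernel_integrable[of "\<lambda>t. cos (t / 2)"] by (simp add: cot_def)

lemma conj_fun_eq: "conj_fun f x = - (1 / pi) * (LINT t:{0<..pi}|lborel. psi f x t * (1 / 2 * cot (t / 2)))"
proof -
  have "((\<lambda>\<epsilon>. LINT t:{\<epsilon>..pi}|lebesgue. psi f x t * (1 / 2 * cot (t / 2)))
      \<longlongrightarrow> (LINT t:{0<..pi}|lebesgue. psi f x t * (1 / 2 * cot (t / 2)))) (at_right 0)"
  proof (rule tendsto_set_lebesgue_integral_at_right)
    show "set_integrable lebesgue {0<..pi} (\<lambda>t. psi f x t * (1 / 2 * cot (t / 2)))"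
      using psi_cot_integrable unfolding set_integrable_def
      by (subst integrable_completion) auto
  qed auto
  then have "((\<lambda>\<epsilon>. conj_trunc f x \<epsilon>)
      \<longlongrightarrow> - (1 / pi) * (LINT t:{0<..pi}|lebesgue. psi f x t * (1 / 2 * cot (t / 2)))) (at_right 0)"
    unfolding conj_trunc_def by (intro tendsto_intros)
  then have "conj_fun f x = - (1 / pi) * (LINT t:{0<..pi}|lebesgue. psi f x t * (1 / 2 * cot (t / 2)))"
    unfolding conj_fun_def by (intro tendsto_Lim) auto
  moreover have "(LINT t:{0<..pi}|lebesgue. psi f x t * (1 / 2 * cot (t / 2)))
      = (LINT t:{0<..pi}|lborel. psi f x t * (1 / 2 * cot (t / 2)))"
    by (rule lebesgue_set_integral_eq_lborel[OF psi_cot_integrable]) simp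
  ultimately show ?thesis by simp
qed

lemma conj_partial_sum_minus_conj_fun:
  "conj_partial_sum f k x - conj_fun f x
    = 1 / pi * (LINT t:{0<..pi}|lborel. psi f x t * (cos ((real k + 1 / 2) * t) / (2 * sin (t / 2))))"
proof -
  have int: "set_integrable lborel {0<..pi} (\<lambda>t. psi f x t * (cos ((real k + 1 / 2) * t) / (2 * sin (t / 2))))"
    by (rule psi_kernel_integrable) auto
  have "(LINT t:{0<..pi}|lborel. psi f x t * (\<Sum>\<nu>=1..k. sin (real \<nu> * t)))
      = (LINT t:{0<..pi}|lborel. psi f x t * (1 / 2 * cot (t / 2))
          - psi f x t * (cos ((real k + 1 / 2) * t) / (2 * sin (t / 2))))"
    by (rule set_lebesgue_integral_cong)
       (simp, intro allI impI, simp only: conj_Dirichlet_kernel right_diff_distrib greaterThanAtMost_iff)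
  also have "\<dots> = (LINT t:{0<..pi}|lborel. psi f x t * (1 / 2 * cot (t / 2)))
      - (LINT t:{0<..pi}|lborel. psi f x t * (cos ((real k + 1 / 2) * t) / (2 * sin (t / 2))))"
    by (rule set_integral_diff(2)[OF psi_cot_integrable int])
  finally show ?thesis
    unfolding conj_partial_sum_eq conj_fun_eq by (simp only: right_diff_distrib)
qed

text \<open>Since the row sums to \<open>1\<close>, the deviation is the weighted series of the deviations of the partial
  sums. The series of integrals converges absolutely, with majorant \<open>a n k\<close> times a fixed integral.\<close>

lemma conj_mean_minus_conj_fun:
  assumes nn: "\<And>k. 0 \<le> a n k" and a1: "a n sums 1"
  shows "conj_mean a f n x - conj_fun f x = (LINT t:{0<..pi}|lborel. psi f x t * residual_kernel (a n) 0 t)"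
proof -
  define q where "q k t = indicator {0<..pi} t *\<^sub>R (a n k * (psi f x t * (cos ((real k + 1 / 2) * t) / (2 * sin (t / 2)))))" for k t
  define q0 where "q0 t = indicator {0<..pi} t *\<^sub>R (psi f x t * (1 / (2 * sin (t / 2))))" for t
  have q_int: "integrable lborel (q k)" for k
    unfolding q_def set_integrable_def[symmetric]
    by (intro set_integrable_mult_right psi_kernel_integrable) auto
  have q0_int: "integrable lborel q0"
    unfolding q0_def set_integrable_def[symmetric] by (rule psi_kernel_integrable) auto
  have q_le: "norm (q k t) \<le> a n k * norm (q0 t)" for k t
  proof -
    have "norm (q k t) = a n k * norm (q0 t) * \<bar>cos ((real k + 1 / 2) * t)\<bar>"
      unfolding q_def q0_def using nn[of k] by (simp add: abs_mult)
    also have "\<dots> \<le> a n k * norm (q0 t) * 1" using nn[of k] by (intro mult_left_mono) auto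
    finally show ?thesis by simp
  qed
  have sa: "summable (a n)" using a1 by (simp add: sums_iff)
  have "(\<lambda>k. integral\<^sup>L lborel (q k)) sums (\<integral>t. (\<Sum>k. q k t) \<partial>lborel)"
  proof (rule sums_integral[OF q_int])
    have "summable (\<lambda>k. norm (q k t))" for t
      by (rule summable_comparison_test'[OF summable_mult2[OF sa, of "norm (q0 t)"], of 0]) (simp add: q_le[simplified])
    then show "AE t in lborel. summable (\<lambda>k. norm (q k t))" by simp
    show "summable (\<lambda>k. \<integral>t. norm (q k t) \<partial>lborel)"
    proof (rule summable_comparison_test'[OF summable_mult2[OF sa, of "\<integral>t. norm (q0 t) \<partial>lborel"], of 0])
      fix k
      have "(\<integral>t. norm (q k t) \<partial>lborel) \<le> (\<integral>t. a n k * norm (q0 t) \<partial>lborel)"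
        by (intro integral_mono integrable_norm integrable_mult_right q_int q0_int q_le)
      then show "norm (\<integral>t. norm (q k t) \<partial>lborel) \<le> a n k * (\<integral>t. norm (q0 t) \<partial>lborel)"
        by simp
    qed
  qed
  moreover have "(\<Sum>k. q k t) = pi * (indicator {0<..pi} t *\<^sub>R (psi f x t * residual_kernel (a n) 0 t))" for t
  proof (cases "t \<in> {0<..pi}")
    case True
    have "summable (\<lambda>k. a n k * cos ((real k + 1 / 2) * t))"
      by (rule summable_mult_bounded[OF nn a1]) simp
    from suminf_mult[OF this, of "psi f x t / (2 * sin (t / 2))"] show ?thesis
      using True by (simp add: q_def residual_kernel_def mean_kernel_def mult_ac)
  qed (simp add: q_def)
  moreover have "integral\<^sup>L lborel (q k) = pi * (a n k * (conj_partial_sum f k x - conj_fun f x))" for k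
    unfolding q_def set_lebesgue_integral_def[symmetric] conj_partial_sum_minus_conj_fun set_integral_mult_right
    by simp
  ultimately have "(\<lambda>k. pi * (a n k * (conj_partial_sum f k x - conj_fun f x)))
      sums (pi * (LINT t:{0<..pi}|lborel. psi f x t * residual_kernel (a n) 0 t))"
    by (simp add: set_lebesgue_integral_def)
  then have "(\<lambda>k. a n k * (conj_partial_sum f k x - conj_fun f x))
      sums (LINT t:{0<..pi}|lborel. psi f x t * residual_kernel (a n) 0 t)"
    by (subst (asm) sums_mult_iff) auto
  from sums_add[OF this sums_mult2[OF a1, of "conj_fun f x"]]
  have "(\<lambda>k. a n k * conj_partial_sum f k x)
      sums ((LINT t:{0<..pi}|lborel. psi f x t * residual_kernel (a n) 0 t) + conj_fun f x)"
    by (simp add: algebra_simps)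
  then show ?thesis unfolding conj_mean_def by (simp add: sums_iff)
qed

lemma conj_mean_minus_conj_trunc:
  assumes nn: "\<And>k. 0 \<le> a n k" and a1: "a n sums 1" and \<epsilon>: "0 < \<epsilon>"
  shows "conj_mean a f n x - conj_trunc f x \<epsilon> = (LINT t:{0<..pi}|lborel. psi f x t * residual_kernel (a n) \<epsilon> t)"
proof -
  let ?g = "\<lambda>t. psi f x t * (1 / 2 * cot (t / 2))"
  have i1: "set_integrable lborel {0<..pi} (\<lambda>t. ?g t * indicator {\<epsilon>..} t)"
    and i2: "set_integrable lborel {0<..pi} (\<lambda>t. ?g t * indicator {..<\<epsilon>} t)"
    by (rule set_integrable_mult_bounded[OF psi_cot_integrable, of _ 1]; simp add: indicator_def)+
  have i0: "set_integrable lborel {0<..pi} (\<lambda>t. psi f x t * residual_kernel (a n) 0 t)"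
  proof -
    have "set_integrable lborel {0<..pi} (\<lambda>t. 1 / pi * (psi f x t * (mean_kernel (a n) t / (2 * sin (t / 2)))))"
      by (intro set_integrable_mult_right psi_kernel_integrable abs_mean_kernel_le_1 nn a1) measurable
    then show ?thesis
      by (rule iffD1[OF set_integrable_cong, rotated -1]) (auto simp: residual_kernel_def)
  qed
  have "set_integrable lborel {\<epsilon>..pi} ?g"
    by (rule set_integrable_subset[OF psi_cot_integrable]) (use \<epsilon> in auto)
  then have "(LINT t:{\<epsilon>..pi}|lebesgue. ?g t) = (LINT t:{\<epsilon>..pi}|lborel. ?g t)"
    by (rule lebesgue_set_integral_eq_lborel) simp
  also have "\<dots> = (LINT t:{0<..pi}|lborel. ?g t * indicator {\<epsilon>..} t)"
    unfolding set_lebesgue_integral_def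
    by (intro Bochner_Integration.integral_cong) (use \<epsilon> in \<open>auto simp: indicator_def\<close>)
  finally have trunc: "conj_trunc f x \<epsilon> = - (1 / pi) * (LINT t:{0<..pi}|lborel. ?g t * indicator {\<epsilon>..} t)"
    unfolding conj_trunc_def by simp
  have "(LINT t:{0<..pi}|lborel. ?g t) = (LINT t:{0<..pi}|lborel. ?g t * indicator {\<epsilon>..} t + ?g t * indicator {..<\<epsilon>} t)"
    by (rule set_lebesgue_integral_cong) (auto simp: indicator_def)
  also have "\<dots> = (LINT t:{0<..pi}|lborel. ?g t * indicator {\<epsilon>..} t) + (LINT t:{0<..pi}|lborel. ?g t * indicator {..<\<epsilon>} t)"
    by (rule set_integral_add(2)[OF i1 i2])
  finally have split: "(LINT t:{0<..pi}|lborel. ?g t) = (LINT t:{0<..pi}|lborel. ?g t * indicator {\<epsilon>..} t)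
      + (LINT t:{0<..pi}|lborel. ?g t * indicator {..<\<epsilon>} t)" .
  have alg: "m - - (1 / pi) * G1 = (m - - (1 / pi) * (G1 + G2)) - 1 / pi * G2" for m G1 G2 :: real
    by (simp add: algebra_simps add_divide_distrib)
  have "conj_mean a f n x - conj_trunc f x \<epsilon>
      = (conj_mean a f n x - conj_fun f x) - 1 / pi * (LINT t:{0<..pi}|lborel. ?g t * indicator {..<\<epsilon>} t)"
    unfolding trunc conj_fun_eq split by (rule alg)
  also have "\<dots> = (LINT t:{0<..pi}|lborel. psi f x t * residual_kernel (a n) 0 t - 1 / pi * (?g t * indicator {..<\<epsilon>} t))"
    unfolding conj_mean_minus_conj_fun[of a n, OF nn a1]
    by (subst set_integral_diff(2)[OF i0 set_integrable_mult_right[OF i2]]) simp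
  also have "\<dots> = (LINT t:{0<..pi}|lborel. psi f x t * residual_kernel (a n) \<epsilon> t)"
    by (rule set_lebesgue_integral_cong) (auto simp: residual_kernel_def indicator_def algebra_simps)
  finally show ?thesis .
qed

end

end

section \<open>Borel representatives\<close>

lemma lebesgue_integral_cong_borel:
  fixes g h :: "real \<Rightarrow> real"
  assumes h: "h \<in> borel_measurable borel" and ae: "AE x in lborel. g x = h x"
  shows "integral\<^sup>L lebesgue g = integral\<^sup>L lebesgue h"
    and "integrable lebesgue g \<longleftrightarrow> integrable lebesgue h"
proof -
  have h': "h \<in> borel_measurable lebesgue" by (rule measurable_completion) (simp add: h)
  have ae': "AE x in lebesgue. h x = g x" unfolding AE_completion_iff using ae by eventually_elim simp
  have g': "g \<in> borel_measurable lebesgue" by (rule borel_measurable_AE[OF h' ae'])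
  show "integral\<^sup>L lebesgue g = integral\<^sup>L lebesgue h"
    by (rule integral_cong_AE[OF g' h']) (use ae' in eventually_elim, simp)
  show "integrable lebesgue g \<longleftrightarrow> integrable lebesgue h"
    by (rule integrable_cong_AE[OF g' h']) (use ae' in eventually_elim, simp)
qed

lemma X_cong_AE:
  assumes X: "X \<noteq> Cont" and g: "periodic_2pi g" and h: "periodic_2pi h" "h \<in> borel_measurable borel"
    and ae: "AE x in lborel. g x = h x"
  shows "g \<in> X_carrier X \<longleftrightarrow> h \<in> X_carrier X" "X_norm X g = X_norm X h"
proof -
  note [measurable] = h(2)
  have h': "h \<in> borel_measurable lebesgue" by (rule measurable_completion) simp
  have ae': "AE x in lebesgue. h x = g x" unfolding AE_completion_iff using ae by eventually_elim simp
  have g': "g \<in> borel_measurable lebesgue" by (rule borel_measurable_AE[OF h' ae'])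
  have ae_p: "AE x in lborel. indicat_real Q x *\<^sub>R \<bar>g x\<bar> powr p = indicat_real Q x *\<^sub>R \<bar>h x\<bar> powr p" for p
    using ae by eventually_elim simp
  have m_p: "(\<lambda>x. indicat_real Q x *\<^sub>R \<bar>h x\<bar> powr p) \<in> borel_measurable borel" for p by measurable
  have ess: "esssup (restrict_space lebesgue Q) (\<lambda>t. ereal \<bar>g t\<bar>) = esssup (restrict_space lebesgue Q) (\<lambda>t. ereal \<bar>h t\<bar>)"
  proof (rule esssup_AE_cong)
    have [measurable]: "g \<in> borel_measurable (restrict_space lebesgue Q)" "h \<in> borel_measurable (restrict_space lebesgue Q)"
      using g' h' by (auto intro: measurable_restrict_space1)
    show "(\<lambda>t. ereal \<bar>g t\<bar>) \<in> borel_measurable (restrict_space lebesgue Q)"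
      "(\<lambda>t. ereal \<bar>h t\<bar>) \<in> borel_measurable (restrict_space lebesgue Q)" by measurable
    have "AE x in restrict_space lebesgue Q. h x = g x"
      using ae' by (simp add: AE_restrict_space_iff) (erule eventually_mono, simp)
    then show "AE x in restrict_space lebesgue Q. ereal \<bar>g x\<bar> = ereal \<bar>h x\<bar>"
      by eventually_elim simp
  qed
  show "g \<in> X_carrier X \<longleftrightarrow> h \<in> X_carrier X"
    using X g h g' h' ess lebesgue_integral_cong_borel(2)[OF m_p ae_p]
    by (cases X) (simp_all add: set_integrable_def)
  show "X_norm X g = X_norm X h"
    using X ess lebesgue_integral_cong_borel(1)[OF m_p ae_p]
    by (cases X) (simp_all add: set_lebesgue_integral_def)
qed

text \<open>A Borel representative is made periodic by copying its values on \<open>[-\<pi>, \<pi>)\<close>.\<close>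

lemma borel_representative:
  assumes f: "f \<in> borel_measurable lebesgue" and per: "periodic_2pi f"
  obtains g where "g \<in> borel_measurable borel" "periodic_2pi g" "AE x in lborel. f x = g x"
proof -
  obtain g0 where g0: "g0 \<in> borel_measurable lborel" "AE x in lborel. f x = g0 x"
    using completion_ex_borel_measurable_real[OF f] by blast
  have [measurable]: "g0 \<in> borel_measurable borel" using g0(1) by simp
  define g where "g x = g0 (x - 2 * pi * of_int \<lfloor>(x + pi) / (2 * pi)\<rfloor>)" for x
  have fl: "\<lfloor>(x + 2 * pi + pi) / (2 * pi)\<rfloor> = \<lfloor>(x + pi) / (2 * pi)\<rfloor> + 1" for x
  proof -
    have "(x + 2 * pi + pi) / (2 * pi) = (x + pi) / (2 * pi) + 1" by (simp add: field_simps)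
    then show ?thesis by simp
  qed
  have g_per: "periodic_2pi g"
    unfolding periodic_2pi_def g_def fl by (simp add: algebra_simps)
  show ?thesis
  proof (rule that[OF _ g_per])
    show "g \<in> borel_measurable borel" unfolding g_def by measurable
    show "AE x in lborel. f x = g x"
    proof (rule periodic_AE)
      show "(f (x + 2 * pi) = g (x + 2 * pi)) = (f x = g x)" for x
        using per g_per by (simp add: periodic_2pi_def)
      \<comment> \<open>At \<open>\<pi>\<close> the copy carries the value from \<open>-\<pi>\<close>, which may differ there from that of \<open>f\<close>.\<close>
      have "AE x in lborel. x \<noteq> pi" by (rule AE_lborel_singleton)
      with g0(2) show "AE x in lborel. x \<in> Q \<longrightarrow> f x = g x"
      proof eventually_elim
        case (elim x)
        show ?case
        proof
          assume "x \<in> Q"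
          with elim(2) have "\<lfloor>(x + pi) / (2 * pi)\<rfloor> = 0" by (intro floor_unique) auto
          then show "f x = g x" using elim(1) by (simp add: g_def)
        qed
      qed
    qed
  qed
qed

lemma psi_AE_eq:
  assumes "AE x in lborel. f x = g x"
  shows "AE t in lborel. psi f x t = psi g x t" "AE x in lborel. psi f x t = psi g x t"
proof -
  have "AE t in lborel. f (x + 1 * t) = g (x + 1 * t)" "AE t in lborel. f (x + (-1) * t) = g (x + (-1) * t)"
    by (rule AE_lborel_affine[OF assms]; simp)+
  then show "AE t in lborel. psi f x t = psi g x t"
    by eventually_elim (simp add: psi_def)
  have "AE x in lborel. f (t + 1 * x) = g (t + 1 * x)" "AE x in lborel. f (- t + 1 * x) = g (- t + 1 * x)"
    by (rule AE_lborel_affine[OF assms]; simp)+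
  then show "AE x in lborel. psi f x t = psi g x t"
    by eventually_elim (simp add: psi_def add.commute)
qed

lemma conj_operators_cong_AE:
  assumes [measurable]: "g \<in> borel_measurable borel" and ae: "AE x in lborel. f x = g x"
  shows "conj_mean a f = conj_mean a g" "conj_trunc f = conj_trunc g" "conj_fun f = conj_fun g"
proof -
  have int_eq: "integral\<^sup>L lebesgue (\<lambda>t. indicat_real Q t *\<^sub>R (f t * b t))
      = integral\<^sup>L lebesgue (\<lambda>t. indicat_real Q t *\<^sub>R (g t * b t))"
    if [measurable]: "b \<in> borel_measurable borel" for b
    by (rule lebesgue_integral_cong_borel(1)) (measurable, use ae in eventually_elim, simp)
  have "fourier_a f \<nu> = fourier_a g \<nu>" "fourier_b f \<nu> = fourier_b g \<nu>" for \<nu>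
    unfolding fourier_a_def fourier_b_def set_lebesgue_integral_def
    by (simp_all only: int_eq[of "\<lambda>t. cos (real \<nu> * t)"] int_eq[of "\<lambda>t. sin (real \<nu> * t)"]
        borel_measurable_continuous_onI continuous_intros)
  then show "conj_mean a f = conj_mean a g"
    by (simp add: conj_mean_def conj_partial_sum_def fun_eq_iff)
  have "integral\<^sup>L lebesgue (\<lambda>t. indicat_real {\<epsilon>..pi} t *\<^sub>R (psi f x t * (1 / 2 * cot (t / 2))))
      = integral\<^sup>L lebesgue (\<lambda>t. indicat_real {\<epsilon>..pi} t *\<^sub>R (psi g x t * (1 / 2 * cot (t / 2))))" for x \<epsilon>
  proof (rule lebesgue_integral_cong_borel(1))
    show "(\<lambda>t. indicat_real {\<epsilon>..pi} t *\<^sub>R (psi g x t * (1 / 2 * cot (t / 2)))) \<in> borel_measurable borel"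
      unfolding cot_def by measurable
    show "AE t in lborel. indicat_real {\<epsilon>..pi} t *\<^sub>R (psi f x t * (1 / 2 * cot (t / 2)))
        = indicat_real {\<epsilon>..pi} t *\<^sub>R (psi g x t * (1 / 2 * cot (t / 2)))"
      using psi_AE_eq(1)[OF ae, of x] by eventually_elim simp
  qed
  then have "conj_trunc f x \<epsilon> = conj_trunc g x \<epsilon>" for x \<epsilon>
    unfolding conj_trunc_def set_lebesgue_integral_def by (simp only:)
  then show "conj_trunc f = conj_trunc g" by (simp add: fun_eq_iff)
  then show "conj_fun f = conj_fun g" by (simp add: conj_fun_def fun_eq_iff)
qed

text \<open>The expression \<open>f (x + t)\<close> need not be jointly measurable with respect to a product of Borel
  algebras if \<open>f\<close> is merely Lebesgue measurable. All operators involved, and the integral and essential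
  supremum norms, ignore null sets, so \<open>f\<close> may be replaced by a Borel function; a continuous \<open>f\<close> is one.\<close>

lemma X_class_borel_representative:
  assumes f: "f \<in> X_class X \<omega>"
  obtains g where "g \<in> borel_measurable borel" "g \<in> X_class X \<omega>"
    "conj_mean a f = conj_mean a g" "conj_trunc f = conj_trunc g" "conj_fun f = conj_fun g"
proof (cases "X = Cont")
  case True
  then have "f \<in> borel_measurable borel"
    using f by (auto simp: X_class_def intro: borel_measurable_continuous_onI)
  then show ?thesis using f by (intro that) auto
next
  case False
  have per: "periodic_2pi f" and meas: "f \<in> borel_measurable lebesgue"
    using f False by (cases X; simp add: X_class_def)+
  obtain g where g: "g \<in> borel_measurable borel" "periodic_2pi g" "AE x in lborel. f x = g x"
    using borel_representative[OF meas per] by blast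
  note [measurable] = g(1)
  have "X_norm X (\<lambda>x. psi f x t) = X_norm X (\<lambda>x. psi g x t)" for t
  proof (rule X_cong_AE(2)[OF False _ _ _ psi_AE_eq(2)[OF g(3)]])
    show "periodic_2pi (\<lambda>x. psi f x t)" "periodic_2pi (\<lambda>x. psi g x t)"
      using psi_periodic[OF per] psi_periodic[OF g(2)]
      by (simp_all add: periodic_2pi_def[of "\<lambda>x. psi _ x t"])
  qed measurable
  then have "conj_modulus2 X f = conj_modulus2 X g"
    by (simp add: conj_modulus2_def fun_eq_iff)
  moreover have "g \<in> X_carrier X"
    using X_cong_AE(1)[OF False per g(2,1,3)] f by (simp add: X_class_def)
  ultimately have "g \<in> X_class X \<omega>" using f by (simp add: X_class_def)
  then show ?thesis using conj_operators_cong_AE[OF g(1,3)] g(1) by (intro that) auto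
qed

section \<open>The rate of approximation\<close>

lemma X_carrier_integrable:
  assumes X: "admissible X" and f: "f \<in> X_carrier X" and [measurable]: "f \<in> borel_measurable borel"
  shows "set_integrable lborel Q f"
proof -
  have Q_fin: "emeasure lborel Q < \<infinity>" by simp
  have "(\<integral>\<^sup>+x\<in>Q. ennreal \<bar>f x\<bar> \<partial>lborel) < \<infinity>"
  proof (cases X)
    case (Lp p)
    then have p: "1 \<le> p" using X by simp
    have "(\<integral>\<^sup>+x\<in>Q. ennreal \<bar>f x\<bar> \<partial>lborel) \<le> (\<integral>\<^sup>+x. indicator Q x + ennreal (\<bar>f x\<bar> powr p) * indicator Q x \<partial>lborel)"
    proof (rule nn_integral_mono)
      fix x
      have "\<bar>f x\<bar> \<le> 1 + \<bar>f x\<bar> powr p"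
        using powr_mono[OF p, of "\<bar>f x\<bar>"] by (cases "\<bar>f x\<bar> \<le> 1") (auto intro: add_increasing2)
      then have "ennreal \<bar>f x\<bar> \<le> 1 + ennreal (\<bar>f x\<bar> powr p)"
        by (simp flip: ennreal_plus ennreal_1)
      then show "ennreal \<bar>f x\<bar> * indicator Q x \<le> indicator Q x + ennreal (\<bar>f x\<bar> powr p) * indicator Q x"
        by (auto simp: indicator_def)
    qed
    also have "\<dots> = emeasure lborel Q + (\<integral>\<^sup>+x\<in>Q. ennreal (\<bar>f x\<bar> powr p) \<partial>lborel)"
      by (subst nn_integral_add) auto
    also have "\<dots> = emeasure lborel Q + ennreal (X_norm (Lp p) f powr p)"
      using f Lp p by (simp only: Lp_norm_powr)
    also have "\<dots> < \<infinity>" by simp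
    finally show ?thesis .
  next
    case Linf
    have "(\<integral>\<^sup>+x\<in>Q. ennreal \<bar>f x\<bar> \<partial>lborel) \<le> (\<integral>\<^sup>+x\<in>Q. ennreal (X_norm Linf f) \<partial>lborel)"
      using Linf_AE_le[OF f[unfolded Linf]]
      by (intro nn_integral_mono_AE, eventually_elim) (intro mult_right_mono ennreal_leI, auto)
    also have "\<dots> < \<infinity>" by (simp add: nn_integral_cmult_indicator ennreal_mult_less_top)
    finally show ?thesis .
  next
    case Cont
    have "(\<integral>\<^sup>+x\<in>Q. ennreal \<bar>f x\<bar> \<partial>lborel) \<le> (\<integral>\<^sup>+x\<in>Q. ennreal (X_norm Cont f) \<partial>lborel)"
      by (intro nn_integral_mono mult_right_mono ennreal_leI Cont_abs_le) (use f Cont in simp_all)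
    also have "\<dots> < \<infinity>" by (simp add: nn_integral_cmult_indicator ennreal_mult_less_top)
    finally show ?thesis .
  qed
  then show ?thesis by (subst set_integrable_iff_nn_integral_finite) auto
qed

text \<open>With \<open>h = \<pi> / (n + 1)\<close> and \<open>Hh = H h\<close> this is the rate of the theorem. The truncation at \<open>\<epsilon> \<le> h\<close> costs
  only one more integral of \<open>\<omega> t / t\<close> over \<open>(0, h]\<close>.\<close>

lemma residual_kernel_integral_le:
  fixes c :: "nat \<Rightarrow> real"
  assumes nn: "\<And>k. 0 \<le> c k" and c1: "c sums 1"
    and \<omega>: "modulus_type \<omega>" and [measurable]: "\<omega> \<in> borel_measurable borel"
    and r: "1 \<le> r" and h: "0 < h" "h \<le> pi" and \<epsilon>: "\<epsilon> \<le> h" and Hh: "0 \<le> Hh" and C: "0 \<le> C"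
    and near: "(\<integral>\<^sup>+s\<in>{0<..h}. ennreal (\<omega> s / s) \<partial>lborel) \<le> ennreal (C * (h * Hh))"
    and far: "(\<integral>\<^sup>+s\<in>{h..pi}. ennreal (\<omega> s / s ^ 2) \<partial>lborel) \<le> ennreal (C * Hh)"
  shows "(\<integral>\<^sup>+t\<in>{0<..pi}. ennreal (\<omega> t * \<bar>residual_kernel c \<epsilon> t\<bar>) \<partial>lborel)
    \<le> ennreal ((4 * (real r + 1) * pi + 1) * C * (Hh * (h + step_variation c r)))"
proof -
  define V where "V = step_variation c r"
  have V0: "0 \<le> V" unfolding V_def by (rule step_variation_nonneg[OF nn c1])
  define P where "P = C * (h * Hh)"
  define R where "R = C * Hh"
  have P0: "0 \<le> P" and R0: "0 \<le> R" using C h Hh by (simp_all add: P_def R_def)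
  have "(\<integral>\<^sup>+t\<in>{0<..pi}. ennreal (\<omega> t * \<bar>residual_kernel c \<epsilon> t\<bar>) \<partial>lborel)
      \<le> (\<integral>\<^sup>+t. ennreal (\<omega> t / t * \<bar>mean_kernel c t\<bar>) * indicator {0<..pi} t
          + ennreal (\<omega> t / t) * indicator {0<..h} t \<partial>lborel)"
  proof (rule nn_integral_mono)
    fix t :: real
    show "ennreal (\<omega> t * \<bar>residual_kernel c \<epsilon> t\<bar>) * indicator {0<..pi} t
      \<le> ennreal (\<omega> t / t * \<bar>mean_kernel c t\<bar>) * indicator {0<..pi} t + ennreal (\<omega> t / t) * indicator {0<..h} t"
    proof (cases "t \<in> {0<..pi}")
      case True
      then have t: "0 < t" "t \<le> pi" by auto
      have w0: "0 \<le> \<omega> t" using modulus_nonneg[OF \<omega>, of t] t by linarith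
      define u :: real where "u = (if t \<le> h then 1 else 0)"
      have "\<bar>residual_kernel c \<epsilon> t\<bar> \<le> 1 / (2 * t) * (\<bar>mean_kernel c t\<bar> + (if t < \<epsilon> then 1 else 0))"
        by (rule residual_kernel_le[OF t])
      also have "\<dots> \<le> 1 / t * (\<bar>mean_kernel c t\<bar> + u)"
        using t \<epsilon> by (intro mult_mono) (auto simp: u_def field_simps)
      finally have "\<omega> t * \<bar>residual_kernel c \<epsilon> t\<bar> \<le> \<omega> t * (1 / t * (\<bar>mean_kernel c t\<bar> + u))"
        using w0 by (rule mult_left_mono)
      also have "\<dots> = \<omega> t / t * \<bar>mean_kernel c t\<bar> + \<omega> t / t * u"
        by (simp add: distrib_left)
      finally have "ennreal (\<omega> t * \<bar>residual_kernel c \<epsilon> t\<bar>) \<le> ennreal (\<omega> t / t * \<bar>mean_kernel c t\<bar> + \<omega> t / t * u)"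
        by (rule ennreal_leI)
      also have "\<dots> = ennreal (\<omega> t / t * \<bar>mean_kernel c t\<bar>) + ennreal (\<omega> t / t * u)"
        using w0 t by (intro ennreal_plus) (auto simp: u_def)
      finally show ?thesis using True t by (cases "t \<le> h") (simp_all add: u_def)
    qed simp
  qed
  also have "\<dots> = (\<integral>\<^sup>+t\<in>{0<..pi}. ennreal (\<omega> t / t * \<bar>mean_kernel c t\<bar>) \<partial>lborel) + (\<integral>\<^sup>+s\<in>{0<..h}. ennreal (\<omega> s / s) \<partial>lborel)"
    by (rule nn_integral_add) measurable
  also have "\<dots> \<le> ennreal (4 * (real r + 1) * (P + pi * V * R)) + ennreal P"
    unfolding V_def P_def R_def
    by (intro add_mono near modulus_kernel_integral_le[OF nn c1 \<omega> _ r h near far])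
       (use C Hh h in auto)
  also have "\<dots> = ennreal (4 * (real r + 1) * (P + pi * V * R) + P)"
    using P0 R0 V0 by (intro ennreal_plus[symmetric]) auto
  also have "\<dots> \<le> ennreal ((4 * (real r + 1) * pi + 1) * C * (Hh * (h + V)))"
  proof (rule ennreal_leI)
    have "1 \<le> pi" using pi_gt3 by linarith
    then have "P \<le> pi * P" using P0 mult_right_mono[of 1 pi P] by simp
    then have "4 * (real r + 1) * (P + pi * V * R) + P \<le> 4 * (real r + 1) * (pi * P + pi * V * R) + (P + V * R)"
      using V0 R0 by (intro add_mono mult_left_mono) auto
    also have "\<dots> = (4 * (real r + 1) * pi + 1) * C * (Hh * (h + V))"
      by (simp add: P_def R_def algebra_simps)
    finally show "4 * (real r + 1) * (P + pi * V * R) + P \<le> (4 * (real r + 1) * pi + 1) * C * (Hh * (h + V))" .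
  qed
  finally show ?thesis unfolding V_def .
qed

text \<open>A modulus is unconstrained outside \<open>[0, 2\<pi>]\<close>; freezing it beyond the end points makes it Borel and
  nonnegative on the whole line.\<close>

lemma modulus_clamp:
  assumes \<omega>: "modulus_type \<omega>"
  defines "w \<equiv> \<lambda>t. \<omega> (max 0 (min t (2 * pi)))"
  shows "w \<in> borel_measurable borel" "modulus_type w" "\<And>t. 0 \<le> t \<Longrightarrow> t \<le> 2 * pi \<Longrightarrow> w t = \<omega> t" "\<And>t. 0 \<le> w t"
proof -
  show w_eq: "w t = \<omega> t" if "0 \<le> t" "t \<le> 2 * pi" for t
    using that by (simp add: w_def)
  show "0 \<le> w t" for t
    unfolding w_def by (rule modulus_nonneg[OF \<omega>]) auto
  have cont: "continuous_on {0..2 * pi} \<omega>" and mono: "mono_on {0..2 * pi} \<omega>"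
    and sub: "\<And>\<delta>1 \<delta>2. 0 \<le> \<delta>1 \<and> \<delta>1 \<le> \<delta>2 \<and> \<delta>2 \<le> \<delta>1 + \<delta>2 \<and> \<delta>1 + \<delta>2 \<le> 2 * pi \<longrightarrow>
        \<omega> (\<delta>1 + \<delta>2) \<le> \<omega> \<delta>1 + \<omega> \<delta>2"
    using \<omega> unfolding modulus_type_def by blast+
  have "continuous_on UNIV w"
    unfolding w_def by (rule continuous_on_compose2[OF cont]) (auto intro!: continuous_intros)
  then show "w \<in> borel_measurable borel" by (rule borel_measurable_continuous_onI)
  have "mono_on {0..2 * pi} w"
    using mono w_eq by (auto simp: monotone_on_def)
  moreover have "continuous_on {0..2 * pi} w"
    using \<open>continuous_on UNIV w\<close> by (rule continuous_on_subset) simp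
  moreover have "w 0 = 0" using \<omega> by (simp add: w_def modulus_type_def)
  moreover have "w (d1 + d2) \<le> w d1 + w d2"
    if "0 \<le> d1" "d1 \<le> d2" "d1 + d2 \<le> 2 * pi" for d1 d2
    using sub[of d1 d2] that by (simp add: w_eq)
  ultimately show "modulus_type w" unfolding modulus_type_def by blast
qed

lemma bigo_principal_UNIV_I:
  fixes F G :: "nat \<Rightarrow> real"
  assumes "\<And>n. \<bar>F n\<bar> \<le> B * \<bar>G n\<bar>"
  shows "F \<in> O[principal UNIV](G)"
  using assms by (intro bigoI[of _ B]) (simp add: eventually_principal)

text \<open>Both deviations are integrals of \<open>psi\<close> against a residual kernel, at truncation \<open>0\<close> and
  \<open>\<pi> / (r (n + 1))\<close>. The points without such a representation are negligible because the Dini-type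
  estimate on \<open>(0, \<pi>]\<close> makes \<open>psi x t / t\<close> integrable.\<close>

lemma conj_mean_deviation_bound:
  fixes X :: per_space and \<omega> H f :: "real \<Rightarrow> real" and r :: nat and a :: "nat \<Rightarrow> nat \<Rightarrow> real"
  assumes X: "admissible X" and a: "summation_matrix a" and \<omega>: "modulus_type \<omega>"
    and H0: "\<forall>u\<in>{0<..pi}. 0 \<le> H u"
    and H_int: "set_integrable lebesgue {0<..pi} H"
    and tail: "(\<lambda>u. LINT t:{u..pi}|lebesgue. \<omega> t / t ^ 2) \<in> O[principal {0<..pi}](H)"
    and mean: "(\<lambda>u. LINT t:{0<..u}|lebesgue. H t) \<in> O[principal {0<..pi}](\<lambda>u. u * H u)"
    and f_class: "f \<in> X_class X \<omega>" and r: "1 \<le> r"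
  obtains B where "0 \<le> B"
    and "\<And>n. (\<lambda>x. conj_mean a f n x - conj_fun f x) \<in> X_carrier X"
    and "\<And>n. (\<lambda>x. conj_mean a f n x - conj_trunc f x (pi / (real r * (real n + 1)))) \<in> X_carrier X"
    and "\<And>n. \<bar>X_norm X (\<lambda>x. conj_mean a f n x - conj_fun f x)\<bar>
      \<le> B * (H (pi / (real n + 1)) * (pi / (real n + 1) + mat_var a n r))"
    and "\<And>n. \<bar>X_norm X (\<lambda>x. conj_mean a f n x - conj_trunc f x (pi / (real r * (real n + 1))))\<bar>
      \<le> B * (H (pi / (real n + 1)) * (pi / (real n + 1) + mat_var a n r))"
proof -
  obtain g where g: "g \<in> borel_measurable borel" "g \<in> X_class X \<omega>"
    and eqs: "conj_mean a f = conj_mean a g" "conj_trunc f = conj_trunc g" "conj_fun f = conj_fun g"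
    using X_class_borel_representative[OF f_class] by blast
  note [measurable] = g(1)
  have g_car: "g \<in> X_carrier X" using g(2) by (simp add: X_class_def)
  have g_per: "periodic_2pi g" using g_car by (cases X) auto
  interpret periodic_integrable g
    using g(1) g_per X_carrier_integrable[OF X g_car g(1)] by unfold_locales
  define w where "w t = \<omega> (max 0 (min t (2 * pi)))" for t
  note w = modulus_clamp[OF \<omega>, folded w_def]
  note [measurable] = w(1)
  have "(LINT t:{u..pi}|lebesgue. w t / t ^ 2) = (LINT t:{u..pi}|lebesgue. \<omega> t / t ^ 2)" if "u \<in> {0<..pi}" for u
  proof (rule set_lebesgue_integral_cong)
    show "\<forall>t. t \<in> {u..pi} \<longrightarrow> w t / t ^ 2 = \<omega> t / t ^ 2"
    proof (intro allI impI)
      fix t assume "t \<in> {u..pi}"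
      then have "0 \<le> t" "t \<le> 2 * pi" using that by (auto intro: order_trans[of t pi])
      then show "w t / t ^ 2 = \<omega> t / t ^ 2" by (simp only: w(3))
    qed
  qed simp
  then have tail_w: "(\<lambda>u. LINT t:{u..pi}|lebesgue. w t / t ^ 2) \<in> O[principal {0<..pi}](H)"
    using tail unfolding bigo_def by (simp add: eventually_principal)
  obtain C where C: "0 < C"
    and near: "\<And>u. 0 < u \<Longrightarrow> u \<le> pi \<Longrightarrow> (\<integral>\<^sup>+s\<in>{0<..u}. ennreal (w s / s) \<partial>lborel) \<le> ennreal (C * (u * H u))"
    and far: "\<And>u. 0 < u \<Longrightarrow> u \<le> pi \<Longrightarrow> (\<integral>\<^sup>+s\<in>{u..pi}. ennreal (w s / s ^ 2) \<partial>lborel) \<le> ennreal (C * H u)"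
    using dini_bounds[OF w(2,1) H0 H_int tail_w mean] by blast
  have "conj_modulus2 X g \<in> O[principal {0..2 * pi}](\<omega>)" using g(2) by (simp add: X_class_def)
  then obtain c where c: "0 < c" "\<And>\<delta>. 0 \<le> \<delta> \<Longrightarrow> \<delta> \<le> 2 * pi \<Longrightarrow> \<bar>conj_modulus2 X g \<delta>\<bar> \<le> c * \<bar>\<omega> \<delta>\<bar>"
    unfolding bigo_def eventually_principal by auto
  define N where "N t = c * w t" for t
  have [measurable]: "N \<in> borel_measurable borel" unfolding N_def by measurable
  have N0: "0 \<le> N t" for t using c(1) w(4) by (simp add: N_def)
  have N: "X_norm X (\<lambda>x. psi g x t) \<le> N t" if t: "0 < t" "t \<le> pi" for t
  proof -
    have t': "0 \<le> t" "t \<le> 2 * pi" using t by auto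
    have "X_norm X (\<lambda>x. psi g x t) \<le> conj_modulus2 X g t"
      by (rule psi_norm_le_modulus[OF X g_car g(1) t(1)])
    also have "\<dots> \<le> c * \<bar>\<omega> t\<bar>" using c(2)[OF t'] by linarith
    also have "\<dots> = N t" using w(3)[OF t'] w(4)[of t] by (simp add: N_def)
    finally show ?thesis .
  qed
  have N_int: "(\<integral>\<^sup>+t\<in>{0<..pi}. ennreal (N t * \<bar>k t\<bar>) \<partial>lborel)
      = ennreal c * (\<integral>\<^sup>+t\<in>{0<..pi}. ennreal (w t * \<bar>k t\<bar>) \<partial>lborel)"
    if [measurable]: "k \<in> borel_measurable borel" for k
  proof -
    have "(\<integral>\<^sup>+t\<in>{0<..pi}. ennreal (N t * \<bar>k t\<bar>) \<partial>lborel)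
        = (\<integral>\<^sup>+t. ennreal c * (ennreal (w t * \<bar>k t\<bar>) * indicator {0<..pi} t) \<partial>lborel)"
      using c(1) w(4) by (intro nn_integral_cong) (simp add: N_def indicator_def ennreal_mult mult.assoc)
    also have "\<dots> = ennreal c * (\<integral>\<^sup>+t\<in>{0<..pi}. ennreal (w t * \<bar>k t\<bar>) \<partial>lborel)"
      by (rule nn_integral_cmult) measurable
    finally show ?thesis .
  qed
  have dini: "X_almost_everywhere X (\<lambda>x. set_integrable lborel {0<..pi} (\<lambda>t. psi g x t * (1 / t)))"
  proof (rule kernel_transform_finite[OF X g_car g(1) _ _ N0 N])
    have "(\<integral>\<^sup>+t\<in>{0<..pi}. ennreal (w t * \<bar>1 / t\<bar>) \<partial>lborel) = (\<integral>\<^sup>+s\<in>{0<..pi}. ennreal (w s / s) \<partial>lborel)"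
      by (intro nn_integral_cong) (auto simp: indicator_def)
    also have "\<dots> < \<infinity>" by (rule le_less_trans[OF near]) auto
    finally show "(\<integral>\<^sup>+t\<in>{0<..pi}. ennreal (N t * \<bar>1 / t\<bar>) \<partial>lborel) < \<infinity>"
      by (subst N_int) (auto simp: ennreal_mult_less_top)
  qed measurable
  have nn: "0 \<le> a n k" and a1: "a n sums 1" for n k
    using a by (auto simp: summation_matrix_def)
  define D where "D = c * ((4 * (real r + 1) * pi + 1) * C)"
  have D0: "0 \<le> D" using c(1) C by (simp add: D_def)
  \<comment> \<open>Both assertions are instances of this one, for \<open>\<epsilon> = 0\<close> and for \<open>\<epsilon> = \<pi> / (r (n + 1))\<close>.\<close>
  have est: "\<Phi> \<in> X_carrier X \<and> \<bar>X_norm X \<Phi>\<bar> \<le> D * (H (pi / (real n + 1)) * (pi / (real n + 1) + mat_var a n r))"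
    if per: "periodic_2pi \<Phi>" and \<epsilon>: "\<epsilon> \<le> pi / (real n + 1)"
      and \<Phi>: "\<And>x. set_integrable lborel {0<..pi} (\<lambda>t. psi g x t * (1 / t)) \<Longrightarrow>
        \<Phi> x = (LINT t:{0<..pi}|lborel. psi g x t * residual_kernel (a n) \<epsilon> t)"
    for \<Phi> \<epsilon> n
  proof -
    define h where "h = pi / (real n + 1)"
    have h: "0 < h" "h \<le> pi" by (simp_all add: h_def field_simps)
    have Hh: "0 \<le> H h" using H0 h by auto
    have V: "step_variation (a n) r = mat_var a n r" by (simp add: step_variation_def mat_var_def)
    have "0 \<le> mat_var a n r" unfolding V[symmetric] by (rule step_variation_nonneg[OF nn a1])
    then have W0: "0 \<le> D * (H h * (h + mat_var a n r))" using D0 Hh h by simp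
    have "(\<integral>\<^sup>+t\<in>{0<..pi}. ennreal (N t * \<bar>residual_kernel (a n) \<epsilon> t\<bar>) \<partial>lborel)
        \<le> ennreal c * ennreal ((4 * (real r + 1) * pi + 1) * C * (H h * (h + mat_var a n r)))"
      unfolding V[symmetric] using C
      by (subst N_int, measurable)
         (intro mult_left_mono residual_kernel_integral_le[OF nn a1 w(2,1) r h \<epsilon>[folded h_def] Hh _ near[OF h] far[OF h]], auto)
    also have "\<dots> = ennreal (D * (H h * (h + mat_var a n r)))"
      using c(1) unfolding D_def by (subst ennreal_mult'[symmetric]) (simp_all add: mult.assoc)
    finally have W: "(\<integral>\<^sup>+t\<in>{0<..pi}. ennreal (N t * \<bar>residual_kernel (a n) \<epsilon> t\<bar>) \<partial>lborel)
        \<le> ennreal (D * (H h * (h + mat_var a n r)))" .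
    have rep: "X_almost_everywhere X (\<lambda>x. \<Phi> x = (LINT t:{0<..pi}|lborel. psi g x t * residual_kernel (a n) \<epsilon> t))"
      by (rule X_almost_everywhere_mono[OF dini]) (rule \<Phi>)
    show ?thesis
      using kernel_transform_norm_le[OF X g_car g(1) residual_kernel_measurable \<open>N \<in> borel_measurable borel\<close>
          N0 N W0 W per rep] unfolding h_def by blast
  qed
  have per_mean: "conj_mean a g n (x + 2 * pi) = conj_mean a g n x" for n x
  proof -
    have "sin (real \<nu> * (x + 2 * pi)) = sin (real \<nu> * x)" "cos (real \<nu> * (x + 2 * pi)) = cos (real \<nu> * x)" for \<nu>
    proof -
      have "real \<nu> * (x + 2 * pi) = real \<nu> * x + 2 * real \<nu> * pi" by (simp add: algebra_simps)
      then show "sin (real \<nu> * (x + 2 * pi)) = sin (real \<nu> * x)" "cos (real \<nu> * (x + 2 * pi)) = cos (real \<nu> * x)"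
        by (simp_all only: sin_add cos_add sin_2npi cos_2npi mult_1_right mult_zero_right add_0_right diff_0_right)
    qed
    then show ?thesis by (simp add: conj_mean_def conj_partial_sum_def)
  qed
  have per_trunc: "conj_trunc g (x + 2 * pi) = conj_trunc g x" for x
    by (simp add: conj_trunc_def psi_periodic[OF g_per] fun_eq_iff)
  have full: "(\<lambda>x. conj_mean a g n x - conj_fun g x) \<in> X_carrier X \<and> \<bar>X_norm X (\<lambda>x. conj_mean a g n x - conj_fun g x)\<bar>
      \<le> D * (H (pi / (real n + 1)) * (pi / (real n + 1) + mat_var a n r))" for n
  proof (rule est[where \<epsilon> = 0])
    show "periodic_2pi (\<lambda>x. conj_mean a g n x - conj_fun g x)"
      by (simp add: periodic_2pi_def per_mean conj_fun_def per_trunc)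
    show "conj_mean a g n x - conj_fun g x = (LINT t:{0<..pi}|lborel. psi g x t * residual_kernel (a n) 0 t)"
      if "set_integrable lborel {0<..pi} (\<lambda>t. psi g x t * (1 / t))" for x
      by (rule conj_mean_minus_conj_fun[OF that nn a1])
  qed simp
  have trunc: "(\<lambda>x. conj_mean a g n x - conj_trunc g x (pi / (real r * (real n + 1)))) \<in> X_carrier X \<and>
      \<bar>X_norm X (\<lambda>x. conj_mean a g n x - conj_trunc g x (pi / (real r * (real n + 1))))\<bar>
      \<le> D * (H (pi / (real n + 1)) * (pi / (real n + 1) + mat_var a n r))" for n
  proof (rule est[where \<epsilon> = "pi / (real r * (real n + 1))"])
    show "periodic_2pi (\<lambda>x. conj_mean a g n x - conj_trunc g x (pi / (real r * (real n + 1))))"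
      by (simp add: periodic_2pi_def per_mean per_trunc)
    have "1 * (real n + 1) \<le> real r * (real n + 1)" using r by (intro mult_right_mono) auto
    then show "pi / (real r * (real n + 1)) \<le> pi / (real n + 1)"
      by (intro divide_left_mono) auto
    show "conj_mean a g n x - conj_trunc g x (pi / (real r * (real n + 1)))
        = (LINT t:{0<..pi}|lborel. psi g x t * residual_kernel (a n) (pi / (real r * (real n + 1))) t)"
      if "set_integrable lborel {0<..pi} (\<lambda>t. psi g x t * (1 / t))" for x
      by (rule conj_mean_minus_conj_trunc[OF that nn a1]) (use r in simp)
  qed
  show ?thesis
    by (rule that[OF D0]; unfold eqs; rule conjunct1[OF full] conjunct2[OF full] conjunct1[OF trunc] conjunct2[OF trunc])
qed

text \<open>Each inner sum is a block of \<open>r\<close> consecutive entries, hence at most the variation. The whole sum,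
  bounded away from \<open>0\<close>, is therefore at most \<open>n + 1\<close> times the variation, so that the term
  \<open>\<pi> / (n + 1)\<close> of the rate can be absorbed.\<close>

lemma mesh_le_mat_var:
  assumes a: "summation_matrix a" and r: "1 \<le> r"
    and nz: "\<forall>n. (\<Sum>l=0..n. \<Sum>k=l..r+l-1. a n k) \<noteq> 0"
    and inv: "(\<lambda>n. inverse (\<Sum>l=0..n. \<Sum>k=l..r+l-1. a n k)) \<in> O[principal UNIV](\<lambda>_. 1 :: real)"
  obtains M where "0 \<le> M" "\<And>n. pi / (real n + 1) \<le> M * mat_var a n r"
proof -
  obtain M where M: "0 < M" "\<And>n. \<bar>inverse (\<Sum>l=0..n. \<Sum>k=l..r+l-1. a n k)\<bar> \<le> M"
    using inv unfolding bigo_def eventually_principal by auto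
  have nn: "0 \<le> a n k" and a1: "a n sums 1" for n k
    using a by (auto simp: summation_matrix_def)
  have "pi / (real n + 1) \<le> pi * M * mat_var a n r" for n
  proof -
    define S where "S = (\<Sum>l=0..n. \<Sum>k=l..r+l-1. a n k)"
    have "0 \<le> S" unfolding S_def by (intro sum_nonneg nn)
    moreover have "S \<noteq> 0" using nz unfolding S_def by blast
    ultimately have S: "0 < S" by simp
    have "{l..r+l-1} = {l..<l+r}" for l using r by auto
    then have "S \<le> (\<Sum>l=0..n. mat_var a n r)"
      unfolding S_def mat_var_def step_variation_def[symmetric]
      by (intro sum_mono) (simp add: block_sum_le_step_variation[OF nn a1])
    also have "\<dots> = (real n + 1) * mat_var a n r" by simp
    finally have S_le: "S \<le> (real n + 1) * mat_var a n r" .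
    have "inverse S \<le> M" using M(2)[of n] S by (simp add: S_def)
    then have "1 \<le> M * S" using S by (simp add: field_simps)
    also have "\<dots> \<le> M * ((real n + 1) * mat_var a n r)" using S_le M(1) by (intro mult_left_mono) auto
    finally have "pi * 1 \<le> pi * (M * ((real n + 1) * mat_var a n r))" by (intro mult_left_mono) auto
    then show ?thesis by (simp add: field_simps)
  qed
  then show ?thesis using M(1) by (intro that[of "pi * M"]) auto
qed

theorem theorem1:
  fixes X :: per_space and \<omega> H f :: "real \<Rightarrow> real" and r :: nat
    and a :: "nat \<Rightarrow> nat \<Rightarrow> real"
  assumes "admissible X"
    and "summation_matrix a"
    and "modulus_type \<omega>"
    and "\<forall>u\<in>{0<..pi}. 0 \<le> H u"
    and "set_integrable lebesgue {0<..pi} H"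
    and "(\<lambda>u. LINT t:{u..pi}|lebesgue. \<omega> t / t ^ 2) \<in> O[principal {0<..pi}](H)"
    and "(\<lambda>u. LINT t:{0<..u}|lebesgue. H t) \<in> O[principal {0<..pi}](\<lambda>u. u * H u)"
    and "f \<in> X_class X \<omega>"
    and "1 \<le> r"
  shows "(\<forall>n. (\<lambda>x. conj_mean a f n x - conj_fun f x) \<in> X_carrier X) \<and>
    (\<forall>n. (\<lambda>x. conj_mean a f n x - conj_trunc f x (pi / (real r * (real n + 1)))) \<in> X_carrier X) \<and>
    (\<lambda>n. X_norm X (\<lambda>x. conj_mean a f n x - conj_fun f x))
      \<in> O[principal UNIV](\<lambda>n. H (pi / (real n + 1)) * (pi / (real n + 1) + mat_var a n r)) \<and>
    (\<lambda>n. X_norm X (\<lambda>x. conj_mean a f n x - conj_trunc f x (pi / (real r * (real n + 1)))))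
      \<in> O[principal UNIV](\<lambda>n. H (pi / (real n + 1)) * (pi / (real n + 1) + mat_var a n r)) \<and>
    ((\<forall>n. (\<Sum>l=0..n. \<Sum>k=l..r+l-1. a n k) \<noteq> 0) \<and>
     (\<lambda>n. inverse (\<Sum>l=0..n. \<Sum>k=l..r+l-1. a n k)) \<in> O[principal UNIV](\<lambda>_. 1 :: real) \<longrightarrow>
       (\<lambda>n. X_norm X (\<lambda>x. conj_mean a f n x - conj_fun f x))
         \<in> O[principal UNIV](\<lambda>n. H (pi / (real n + 1)) * mat_var a n r) \<and>
       (\<lambda>n. X_norm X (\<lambda>x. conj_mean a f n x - conj_trunc f x (pi / (real r * (real n + 1)))))
         \<in> O[principal UNIV](\<lambda>n. H (pi / (real n + 1)) * mat_var a n r))"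
proof -
  obtain B where B: "0 \<le> B"
    and car: "\<And>n. (\<lambda>x. conj_mean a f n x - conj_fun f x) \<in> X_carrier X"
      "\<And>n. (\<lambda>x. conj_mean a f n x - conj_trunc f x (pi / (real r * (real n + 1)))) \<in> X_carrier X"
    and norm: "\<And>n. \<bar>X_norm X (\<lambda>x. conj_mean a f n x - conj_fun f x)\<bar>
        \<le> B * (H (pi / (real n + 1)) * (pi / (real n + 1) + mat_var a n r))"
      "\<And>n. \<bar>X_norm X (\<lambda>x. conj_mean a f n x - conj_trunc f x (pi / (real r * (real n + 1))))\<bar>
        \<le> B * (H (pi / (real n + 1)) * (pi / (real n + 1) + mat_var a n r))"
    using conj_mean_deviation_bound[OF assms] by blast
  have abs_le: "B * z \<le> B * \<bar>z\<bar>" for z using B by (intro mult_left_mono) auto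
  have H: "0 \<le> H (pi / (real n + 1))" for n using assms(4) by (simp add: field_simps)
  have better: "F \<in> O[principal UNIV](\<lambda>n. H (pi / (real n + 1)) * mat_var a n r)"
    if F: "\<And>n. \<bar>F n\<bar> \<le> B * (H (pi / (real n + 1)) * (pi / (real n + 1) + mat_var a n r))"
      and M: "0 \<le> M" "\<And>n. pi / (real n + 1) \<le> M * mat_var a n r" for F M
  proof (rule bigo_principal_UNIV_I)
    fix n
    have "B * (H (pi / (real n + 1)) * (pi / (real n + 1) + mat_var a n r))
        \<le> B * (H (pi / (real n + 1)) * (M * mat_var a n r + mat_var a n r))"
      by (intro mult_left_mono add_mono M(2) B H) auto
    also have "\<dots> = B * (M + 1) * (H (pi / (real n + 1)) * mat_var a n r)"
      by (simp add: algebra_simps)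
    also have "\<dots> \<le> B * (M + 1) * \<bar>H (pi / (real n + 1)) * mat_var a n r\<bar>"
      using B M(1) by (intro mult_left_mono) auto
    finally show "\<bar>F n\<bar> \<le> B * (M + 1) * \<bar>H (pi / (real n + 1)) * mat_var a n r\<bar>"
      using F[of n] by linarith
  qed
  show ?thesis
  proof (intro conjI allI impI; (elim conjE)?)
    show "(\<lambda>x. conj_mean a f n x - conj_fun f x) \<in> X_carrier X"
      "(\<lambda>x. conj_mean a f n x - conj_trunc f x (pi / (real r * (real n + 1)))) \<in> X_carrier X" for n
      by (rule car)+
    show "(\<lambda>n. X_norm X (\<lambda>x. conj_mean a f n x - conj_fun f x))
      \<in> O[principal UNIV](\<lambda>n. H (pi / (real n + 1)) * (pi / (real n + 1) + mat_var a n r))"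
      by (rule bigo_principal_UNIV_I) (rule order_trans[OF norm(1) abs_le])
    show "(\<lambda>n. X_norm X (\<lambda>x. conj_mean a f n x - conj_trunc f x (pi / (real r * (real n + 1)))))
      \<in> O[principal UNIV](\<lambda>n. H (pi / (real n + 1)) * (pi / (real n + 1) + mat_var a n r))"
      by (rule bigo_principal_UNIV_I) (rule order_trans[OF norm(2) abs_le])
  next
    assume "\<forall>n. (\<Sum>l=0..n. \<Sum>k=l..r+l-1. a n k) \<noteq> 0"
      and "(\<lambda>n. inverse (\<Sum>l=0..n. \<Sum>k=l..r+l-1. a n k)) \<in> O[principal UNIV](\<lambda>_. 1 :: real)"
    then obtain M where M: "0 \<le> M" "\<And>n. pi / (real n + 1) \<le> M * mat_var a n r"
      using mesh_le_mat_var[OF assms(2,9)] by blast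
    show "(\<lambda>n. X_norm X (\<lambda>x. conj_mean a f n x - conj_fun f x))
         \<in> O[principal UNIV](\<lambda>n. H (pi / (real n + 1)) * mat_var a n r)"
      by (rule better[OF norm(1) M])
    show "(\<lambda>n. X_norm X (\<lambda>x. conj_mean a f n x - conj_trunc f x (pi / (real r * (real n + 1)))))
         \<in> O[principal UNIV](\<lambda>n. H (pi / (real n + 1)) * mat_var a n r)"
      by (rule better[OF norm(2) M])
  qed
qed

end
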